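(* For any $K\in\mathcal{S}$, $$J(K)-J(K^* )\le\frac{\|\Sigma^*\|\,\|S\|^2}{4\,\underline{\sigma}(R)\,\underline{\sigma}^2(\Sigma_K)}\operatorname{tr}\{\nabla J(K)^\top\nabla J(K)\}.$$
   Context: System: $x_{t+1}=Ax_t+Bu_t$, $y_t=Cx_t$, with $x_t\in\mathbb{R}^n$, $u_t\in\mathbb{R}^m$, $y_t\in\mathbb{R}^d$. Standing assumptions: $(A,B)$ is controllable and $(C,A)$ is observable; the weights are symmetric, $Q\ge 0$ (size $d\times d$) and $R>0$ (size $m\times m$); the initial state $x_0$ is random with zero mean and covariance $\Sigma_0=\mathbb{E}[x_0x_0^\top]>0$. Let $p=\max\{o,c\}\le n$, where $o$ and $c$ are the observability and controllability indices, so that $\mathcal{O}=[(CA^{p-1})^\top,\dots,(CA)^\top,C^\top]^\top$ has full column rank and $\mathcal{C}=[B,AB,\dots,A^{p-1}B]$ has full row rank. Let $\mathcal{T}$ be the $p\times p$ block matrix with blocks in $\mathbb{R}^{d\times m}$ whose $(i,j)$ block is $CA^{j-i-1}B$ if $j>i$ and $0$ otherwise. Let $\mathcal{O}^\dagger=(\mathcal{O}^\top\mathcal{O})^{-1}\mathcal{O}^\top$, $q=p(m+d)$, and $$S=[\,\mathcal{C}-A^p\mathcal{O}^\dagger\mathcal{T},\ A^p\mathcal{O}^\dagger\,]\in\mathbb{R}^{n\times q}.$$ $S$ has full row rank; put $S^\dagger=S^\top(SS^\top)^{-1}$. With $z_{t,p}=[u_{t-1}^\top,\dots,u_{t-p}^\top,y_{t-1}^\top,\dots,y_{t-p}^\top]^\top$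 one has $x_t=Sz_{t,p}$. The policies considered are $u_t=-Kz_{t,p}$ with $K\in\mathbb{R}^{m\times q}$ (input-output feedback), and the feasible set is $\mathcal{S}=\{K\in\mathbb{R}^{m\times q} : \rho(A-BKS^\dagger)<1\}$, where $\rho$ is the spectral radius. Put $Q_c=C^\top QC$. For $K\in\mathcal{S}$ the cost (of $\sum_{t\ge0}(y_t^\top Qy_t+u_t^\top Ru_t)$ in expectation over $x_0$) is given by $J(K)=\mathrm{Tr}(P_K\Sigma_0)$, where $P_K\ge0$ is the solution of $P_K=Q_c+(S^\dagger)^\top K^\top RKS^\dagger+(A-BKS^\dagger)^\top P_K(A-BKS^\dagger)$. $\nabla J(K)\in\mathbb{R}^{m\times q}$ is the gradient with respect to the Frobenius inner product. $P^*$ is the unique positive semidefinite solution of the Riccati equation $P^*=A^\top P^*A+Q_c-A^\top P^*B(R+B^\top P^*B)^{-1}B^\top P^*A$, and $K^*=(R+B^\top P^*B)^{-1}B^\top P^*AS$, which is an optimal policy, i.e. a minimizer of $J$ over $\mathcal{S}$ (in particular $K^*\in\mathcal{S}$). For $K\in\mathcal{S}$, $\Sigma_K$ is the solution of $\Sigma_K=\Sigma_0+(A-BKS^\dagger)\Sigma_K(A-BKS^\dagger)^\top$, and $\Sigma^*=\Sigma_{K^*}$. $\underline{\sigma}(\cdot)$ is the smallest eigenvalue of a square matrix and $\|\cdot\|$ the spectral norm. *)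

theory Defs
  imports "HOL-Probability.Probability"
begin

section \<open>Matrices\<close>

text \<open>The class operation \<open>^\<close> on \<open>real ^ 'n ^ 'n\<close> is the entrywise power, so the power of a
  square matrix needs its own definition. Likewise the class order \<open>\<le>\<close> is entrywise and is not
  used for semidefiniteness.\<close>

definition matpow :: "real^'n^'n \<Rightarrow> nat \<Rightarrow> real^'n^'n" where
  "matpow A k = ((\<lambda>X. A ** X) ^^ k) (mat 1)"

definition pos_semidef :: "real^'n^'n \<Rightarrow> bool" where
  "pos_semidef P \<longleftrightarrow> transpose P = P \<and> (\<forall>x. 0 \<le> x \<bullet> (P *v x))"

definition pos_def :: "real^'n^'n \<Rightarrow> bool" where
  "pos_def P \<longleftrightarrow> transpose P = P \<and> (\<forall>x. x \<noteq> 0 \<longrightarrow> 0 < x \<bullet> (P *v x))"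

definition eigenvalues :: "'a::field^'n^'n \<Rightarrow> 'a set" where
  "eigenvalues A = {e. \<exists>v. v \<noteq> 0 \<and> A *v v = e *s v}"

definition spectral_radius :: "real^'n^'n \<Rightarrow> real" where
  "spectral_radius A = Max (cmod ` eigenvalues (\<chi> i j. complex_of_real (A $ i $ j)))"

text \<open>Only applied to symmetric matrices, all of whose eigenvalues are real.\<close>

definition sigma_min :: "real^'n^'n \<Rightarrow> real" where
  "sigma_min A = Min (eigenvalues A)"

definition spectral_norm :: "real^'n^'m \<Rightarrow> real" where
  "spectral_norm A = onorm ((*v) A)"

definition left_pinv :: "real^'n^'m \<Rightarrow> real^'m^'n" where
  "left_pinv A = matrix_inv (transpose A ** A) ** transpose A"

definition right_pinv :: "real^'n^'m \<Rightarrow> real^'m^'n" where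
  "right_pinv A = transpose A ** matrix_inv (A ** transpose A)"

definition outer_product :: "real^'n \<Rightarrow> real^'m \<Rightarrow> real^'m^'n" where
  "outer_product x y = (\<chi> i j. x $ i * y $ j)"

text \<open>The inner product of \<open>real ^ 'q ^ 'm\<close> is the Frobenius inner product.\<close>

definition gradient :: "('a::real_inner \<Rightarrow> real) \<Rightarrow> 'a \<Rightarrow> 'a" where
  "gradient f x = (THE D. GDERIV f x :> D)"


section \<open>Controllability and observability\<close>

text \<open>The rank of \<open>[B, AB, \<dots>, A^(k-1) B]\<close>, as the dimension of its column space, and the rank
  of the matrix with block rows \<open>C, CA, \<dots>, C A^(k-1)\<close>, as the dimension of its row space; the
  number of blocks is a variable here, so it cannot be part of a matrix type.\<close>

definition controllability_rank :: "real^'n^'n \<Rightarrow> real^'m^'n \<Rightarrow> nat \<Rightarrow> nat" where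
  "controllability_rank A B k = dim (\<Union>i<k. columns (matpow A i ** B))"

definition observability_rank :: "real^'n^'d \<Rightarrow> real^'n^'n \<Rightarrow> nat \<Rightarrow> nat" where
  "observability_rank C A k = dim (\<Union>i<k. rows (C ** matpow A i))"

definition controllable :: "real^'n^'n \<Rightarrow> real^'m^'n \<Rightarrow> bool" where
  "controllable A B \<longleftrightarrow> controllability_rank A B CARD('n) = CARD('n)"

definition observable :: "real^'n^'d \<Rightarrow> real^'n^'n \<Rightarrow> bool" where
  "observable C A \<longleftrightarrow> observability_rank C A CARD('n) = CARD('n)"

definition controllability_index :: "real^'n^'n \<Rightarrow> real^'m^'n \<Rightarrow> nat" where
  "controllability_index A B = (LEAST k. controllability_rank A B k = CARD('n))"

definition observability_index :: "real^'n^'d \<Rightarrow> real^'n^'n \<Rightarrow> nat" where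
  "observability_index C A = (LEAST k. observability_rank C A k = CARD('n))"


section \<open>Input-output representation of the state\<close>

text \<open>A linearly ordered index type \<open>'p\<close> with \<open>p\<close> elements plays the role of \<open>{1, \<dots>, p}\<close>:
  \<open>pos i\<close> is the 0-based position of \<open>i\<close>, so \<open>i\<close> stands for the index \<open>pos i + 1\<close>. Block
  vectors with \<open>p\<close> blocks of size \<open>m\<close> are indexed by \<open>'p \<times> 'm\<close>, and the vector of the last
  \<open>p\<close> inputs followed by the last \<open>p\<close> outputs, of length \<open>q = p (m + d)\<close>, is indexed by
  \<open>'p \<times> 'm + 'p \<times> 'd\<close>.\<close>

definition pos :: "'p::{finite,linorder} \<Rightarrow> nat" where
  "pos i = card {..<i}"

text \<open>\<open>[B, AB, \<dots>, A^(p-1) B]\<close>\<close>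

definition ctrb_matrix ::
    "real^'n^'n \<Rightarrow> real^'m^'n \<Rightarrow> real^('p::{finite,linorder} \<times> 'm)^'n" where
  "ctrb_matrix A B = (\<chi> s b. case b of (j, r) \<Rightarrow> (matpow A (pos j) ** B) $ s $ r)"

text \<open>Block rows \<open>C A^(p-1), \<dots>, CA, C\<close>, from top to bottom\<close>

definition obsv_matrix ::
    "real^'n^'d \<Rightarrow> real^'n^'n \<Rightarrow> real^'n^('p::{finite,linorder} \<times> 'd)" where
  "obsv_matrix C A = (\<chi> a s. case a of (i, l) \<Rightarrow> (C ** matpow A (CARD('p) - 1 - pos i)) $ l $ s)"

definition toeplitz_matrix ::
    "real^'n^'n \<Rightarrow> real^'m^'n \<Rightarrow> real^'n^'d \<Rightarrow>
      real^('p::{finite,linorder} \<times> 'm)^('p \<times> 'd)" where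
  "toeplitz_matrix A B C = (\<chi> a b. case (a, b) of ((i, l), (j, r)) \<Rightarrow>
     if i < j then (C ** matpow A (pos j - pos i - 1) ** B) $ l $ r else 0)"

definition io_state_matrix ::
    "real^'n^'n \<Rightarrow> real^'m^'n \<Rightarrow> real^'n^'d \<Rightarrow>
      real^(('p::{finite,linorder} \<times> 'm) + ('p \<times> 'd))^'n" where
  "io_state_matrix A B C =
     (let Y = matpow A CARD('p) ** left_pinv (obsv_matrix C A :: real^'n^('p \<times> 'd));
          U = ctrb_matrix A B - Y ** toeplitz_matrix A B C
      in \<chi> s k. case k of Inl a \<Rightarrow> U $ s $ a | Inr b \<Rightarrow> Y $ s $ b)"


section \<open>Linear quadratic control by input-output feedback\<close>

text \<open>Policies \<open>u = - K z\<close>, where the state is \<open>x = S z\<close>\<close>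

definition closed_loop ::
    "real^'n^'n \<Rightarrow> real^'m^'n \<Rightarrow> real^'q^'n \<Rightarrow> real^'q^'m \<Rightarrow> real^'n^'n" where
  "closed_loop A B S K = A - B ** K ** right_pinv S"

definition feasible_policies ::
    "real^'n^'n \<Rightarrow> real^'m^'n \<Rightarrow> real^'q^'n \<Rightarrow> (real^'q^'m) set" where
  "feasible_policies A B S = {K. spectral_radius (closed_loop A B S K) < 1}"

definition cost_matrix ::
    "real^'n^'n \<Rightarrow> real^'m^'n \<Rightarrow> real^'n^'d \<Rightarrow> real^'d^'d \<Rightarrow> real^'m^'m \<Rightarrow>
      real^'q^'n \<Rightarrow> real^'q^'m \<Rightarrow> real^'n^'n" where
  "cost_matrix A B C Q R S K = (THE P. pos_semidef P \<and>
     P = transpose C ** Q ** C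
         + transpose (right_pinv S) ** transpose K ** R ** K ** right_pinv S
         + transpose (closed_loop A B S K) ** P ** closed_loop A B S K)"

definition lqr_cost ::
    "real^'n^'n \<Rightarrow> real^'m^'n \<Rightarrow> real^'n^'d \<Rightarrow> real^'d^'d \<Rightarrow> real^'m^'m \<Rightarrow> real^'n^'n \<Rightarrow>
      real^'q^'n \<Rightarrow> real^'q^'m \<Rightarrow> real" where
  "lqr_cost A B C Q R \<Sigma>\<^sub>0 S K = trace (cost_matrix A B C Q R S K ** \<Sigma>\<^sub>0)"

definition state_covariance ::
    "real^'n^'n \<Rightarrow> real^'m^'n \<Rightarrow> real^'n^'n \<Rightarrow> real^'q^'n \<Rightarrow> real^'q^'m \<Rightarrow> real^'n^'n" where
  "state_covariance A B \<Sigma>\<^sub>0 S K = (THE X.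
     X = \<Sigma>\<^sub>0 + closed_loop A B S K ** X ** transpose (closed_loop A B S K))"

definition riccati ::
    "real^'n^'n \<Rightarrow> real^'m^'n \<Rightarrow> real^'n^'d \<Rightarrow> real^'d^'d \<Rightarrow> real^'m^'m \<Rightarrow> real^'n^'n \<Rightarrow> bool"
  where
  "riccati A B C Q R P \<longleftrightarrow>
     P = transpose A ** P ** A + transpose C ** Q ** C
         - transpose A ** P ** B ** matrix_inv (R + transpose B ** P ** B)
             ** transpose B ** P ** A"

definition riccati_policy ::
    "real^'n^'n \<Rightarrow> real^'m^'n \<Rightarrow> real^'m^'m \<Rightarrow> real^'q^'n \<Rightarrow> real^'n^'n \<Rightarrow> real^'q^'m" where
  "riccati_policy A B R S P =
     matrix_inv (R + transpose B ** P ** B) ** transpose B ** P ** A ** S"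

end

theory Submission
  imports Defs "HOL-Computational_Algebra.Fundamental_Theorem_Algebra"
begin

text \<open>Write \<open>S^\<dagger>\<close> for the right pseudoinverse of \<open>S\<close>. The cost of an input-output policy \<open>K\<close>
  depends only on the state feedback gain \<open>F = K S^\<dagger>\<close>, and everything rests on an exact formula
  for the difference of two costs (\<open>cost_difference\<close>). Let \<open>P\<close> be the value matrix of \<open>F\<close>, let
  \<open>E = R F - B^T P (A - B F)\<close> and \<open>H = R + B^T P B\<close>. For another stabilizing gain \<open>F + D\<close> with
  state covariance \<open>X'\<close>, the cost changes by the trace of
  \<open>(D^T E + E^T D + D^T H D) X'\<close>.

  The formula is used twice. Read to first order in \<open>D\<close>, it shows that the gradient of the cost at
  \<open>K\<close> is \<open>2 E X (S^\<dagger>)^T\<close>, where \<open>X\<close> is the covariance of \<open>K\<close> itself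
  (\<open>gradient_lqr_cost\<close>); this needs that the covariance depends continuously on the policy and that
  stability is an open condition. Read as an inequality, with the optimal policy as the other one,
  it bounds the cost gap: completing the square, the matrix \<open>D^T E + E^T D + D^T H D\<close> is at least
  \<open>- E^T E / \<sigma>\<close>, with \<open>\<sigma>\<close> the smallest eigenvalue of \<open>R\<close>, so the gap is at most the spectral
  norm of the optimal covariance times \<open>(norm E)\<^sup>2 / \<sigma>\<close>. Since \<open>S\<close> has full row rank,
  multiplying the gradient by \<open>S^T\<close> gives \<open>2 E X\<close>, and the norm of \<open>E\<close> is bounded by that of the
  gradient.

  The covariance and the value matrix are solutions of Stein equations \<open>X = W + A X A^T\<close>. These
  are handled through the single property that the powers of a stable matrix tend to zero: it gives
  uniqueness by iteration, existence by linear algebra, semidefiniteness by a limit, and openness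
  and continuity by perturbation. That a spectral radius below one implies this property
  (\<open>spectral_radius_less_1_imp_schur_stable\<close>) follows from an annihilating polynomial of the matrix
  and its complex roots. Traces of products of semidefinite matrices are bounded by a Cholesky
  decomposition (\<open>trace_mult_psd_nonneg\<close>).\<close>

section \<open>Linearity of the matrix operations\<close>

interpretation matmul: bounded_bilinear "(**) :: real^'n^'m \<Rightarrow> real^'p^'n \<Rightarrow> real^'p^'m"
proof -
  have "bilinear ((**) :: real^'n^'m \<Rightarrow> real^'p^'n \<Rightarrow> real^'p^'m)"
    unfolding bilinear_def
    by (auto intro!: linearI simp: matrix_matrix_mult_def vec_eq_iff algebra_simps
        sum.distrib sum_distrib_left)
  then show "bounded_bilinear ((**) :: real^'n^'m \<Rightarrow> real^'p^'n \<Rightarrow> real^'p^'m)"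
    by (simp add: bilinear_conv_bounded_bilinear)
qed

lemmas matrix_linear_simps =
  matmul.add_left matmul.add_right matmul.diff_left matmul.diff_right
  matmul.minus_left matmul.minus_right matmul.scaleR_left matmul.scaleR_right

lemma bounded_linear_transpose: "bounded_linear (transpose :: real^'n^'m \<Rightarrow> real^'m^'n)"
  unfolding linear_conv_bounded_linear[symmetric]
  by (auto intro!: linearI simp: transpose_def vec_eq_iff)

lemmas transpose_linear_simps =
  linear_add[OF bounded_linear.linear[OF bounded_linear_transpose]]
  linear_diff[OF bounded_linear.linear[OF bounded_linear_transpose]]
  linear_neg[OF bounded_linear.linear[OF bounded_linear_transpose]]
  linear_scale[OF bounded_linear.linear[OF bounded_linear_transpose]]

lemma bounded_linear_mult_vec: "bounded_linear (\<lambda>M :: real^'n^'m. M *v x)"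
  unfolding linear_conv_bounded_linear[symmetric]
  by (auto intro!: linearI simp: matrix_vector_mult_def vec_eq_iff algebra_simps
      sum.distrib sum_distrib_left)

lemmas mult_vec_linear_simps =
  linear_add[OF bounded_linear.linear[OF bounded_linear_mult_vec]]
  linear_diff[OF bounded_linear.linear[OF bounded_linear_mult_vec]]
  linear_neg[OF bounded_linear.linear[OF bounded_linear_mult_vec]]
  linear_scale[OF bounded_linear.linear[OF bounded_linear_mult_vec]]

lemma inner_transpose_mult: "x \<bullet> (transpose M *v y) = (M *v x) \<bullet> (y :: real^_)"
  by (metis dot_lmul_matrix inner_commute transpose_matrix_vector)

lemma matrix_mult_assoc: "(X ** Y) ** Z = X ** (Y ** Z)"
  by (simp add: matrix_mul_assoc)

lemma inner_matrix_eq_trace: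
  fixes X Y :: "real^'n^'m"
  shows "X \<bullet> Y = trace (transpose X ** Y)"
  unfolding trace_def transpose_def matrix_matrix_mult_def inner_vec_def
  by (simp, rule sum.swap)

lemma trace_transpose: "trace (transpose X) = trace X"
  by (simp add: trace_def transpose_def)

lemma trace_linear_simps:
  fixes X Y :: "real^'n^'n"
  shows "trace (X + Y) = trace X + trace Y" "trace (X - Y) = trace X - trace Y"
    "trace (c *\<^sub>R X) = c * trace X"
  by (simp_all add: trace_def sum.distrib sum_subtractf sum_distrib_left)

section \<open>Semidefinite matrices\<close>

lemma symmetric_inner_swap:
  fixes P :: "real^'n^'n"
  assumes "transpose P = P"
  shows "x \<bullet> (P *v y) = y \<bullet> (P *v x)"
  by (metis assms inner_commute inner_transpose_mult)

lemma psd_Cauchy_Schwarz: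
  assumes "pos_semidef P"
  shows "(x \<bullet> (P *v y))\<^sup>2 \<le> (x \<bullet> (P *v x)) * (y \<bullet> (P *v y))"
proof -
  define a b c where "a = x \<bullet> (P *v x)" and "b = x \<bullet> (P *v y)" and "c = y \<bullet> (P *v y)"
  have sym: "y \<bullet> (P *v x) = b"
    using assms symmetric_inner_swap unfolding pos_semidef_def b_def by metis
  have quad: "0 \<le> s\<^sup>2 * a + 2 * (s * t) * b + t\<^sup>2 * c" for s t
  proof -
    have "0 \<le> (s *\<^sub>R x + t *\<^sub>R y) \<bullet> (P *v (s *\<^sub>R x + t *\<^sub>R y))"
      using assms by (simp add: pos_semidef_def)
    also have "\<dots> = s\<^sup>2 * a + 2 * (s * t) * b + t\<^sup>2 * c"
      using sym by (simp add: a_def b_def c_def inner_simps algebra_simps power2_eq_square)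
    finally show ?thesis .
  qed
  have nn: "0 \<le> a" "0 \<le> c" using assms by (auto simp: a_def c_def pos_semidef_def)
  have "b\<^sup>2 \<le> a * c"
  proof (cases "c = 0")
    case True
    have "b = 0"
    proof (rule ccontr)
      assume "b \<noteq> 0"
      \<comment> \<open>for \<open>c = 0\<close> the form is affine in \<open>t\<close>; this \<open>t\<close> makes it \<open>-1\<close>\<close>
      have "0 \<le> a + 2 * (- (a + 1) / (2 * b)) * b"
        using quad[of 1 "- (a + 1) / (2 * b)"] True by simp
      with \<open>b \<noteq> 0\<close> show False by (simp add: field_simps)
    qed
    then show ?thesis using True by simp
  next
    case False
    with nn have "0 < c" by simp
    \<comment> \<open>the vector \<open>c x - b y\<close> is orthogonal to \<open>y\<close> for the form\<close>
    have "0 \<le> c * (a * c - b\<^sup>2)"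
      using quad[of c "-b"] by (simp add: power2_eq_square algebra_simps)
    with \<open>0 < c\<close> show ?thesis by (simp add: zero_le_mult_iff)
  qed
  then show ?thesis by (simp add: a_def b_def c_def)
qed

text \<open>A zero of a nonnegative quadratic form is a minimizer, hence a critical point.\<close>

lemma psd_null_vector:
  assumes "pos_semidef P" "x \<bullet> (P *v x) = 0"
  shows "P *v x = 0"
proof -
  have "((P *v x) \<bullet> (P *v x))\<^sup>2 \<le> 0"
    using psd_Cauchy_Schwarz[OF assms(1), of "P *v x" x] assms(2) by simp
  then show ?thesis by simp
qed

lemma pos_def_imp_psd: "pos_def P \<Longrightarrow> pos_semidef P"
  unfolding pos_def_def pos_semidef_def
  by (metis inner_zero_left order.strict_implies_order order.refl)

lemma psd_congruence:
  assumes "pos_semidef P"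
  shows "pos_semidef (transpose N ** P ** N)"
proof -
  have "0 \<le> x \<bullet> ((transpose N ** P ** N) *v x)" for x
    using assms
    by (simp only: matrix_vector_mul_assoc[symmetric] inner_transpose_mult matrix_mult_assoc pos_semidef_def)
  then show ?thesis
    using assms by (simp add: pos_semidef_def matrix_transpose_mul matrix_mult_assoc)
qed

lemma psd_add: "pos_semidef P \<Longrightarrow> pos_semidef P' \<Longrightarrow> pos_semidef (P + P')"
  by (simp add: pos_semidef_def transpose_linear_simps mult_vec_linear_simps inner_add_right)

lemma outer_product_mult_vec: "outer_product v w *v x = (w \<bullet> x) *\<^sub>R v"
  by (simp add: outer_product_def matrix_vector_mult_def vec_eq_iff inner_vec_def
      sum_distrib_left sum_distrib_right mult_ac)

lemma trace_mult_outer_product: "trace (M ** outer_product v v) = v \<bullet> (M *v v)"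
  for M :: "real^'n^'n"
  by (simp add: outer_product_def trace_def matrix_matrix_mult_def matrix_vector_mult_def
      inner_vec_def sum_distrib_left mult_ac)

text \<open>Cholesky elimination: if \<open>P $ i $ i \<noteq> 0\<close>, subtracting the outer product of the
  normalized \<open>i\<close>-th column with itself leaves a matrix that is semidefinite by Cauchy-Schwarz and
  has more zeros on its diagonal; a semidefinite matrix with zero diagonal vanishes. This
  replaces the spectral theorem wherever a trace has to be bounded.\<close>

lemma psd_sum_of_outer_products:
  assumes "pos_semidef (P :: real^'n^'n)"
  shows "\<exists>vs. P = (\<Sum>v\<leftarrow>vs. outer_product v v)"
  using assms
proof (induction "card {i. P $ i $ i \<noteq> 0}" arbitrary: P rule: less_induct)
  case less
  have diag: "axis i 1 \<bullet> (P *v axis i 1) = P $ i $ i" for i and P :: "real^'n^'n"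
    by (simp add: inner_axis' matrix_vector_mult_basis column_def)
  show ?case
  proof (cases "\<exists>i. P $ i $ i \<noteq> 0")
    case False
    have "P *v axis i 1 = 0" for i
      using psd_null_vector[OF less.prems] False diag by metis
    then have "P $ j $ i = 0" for i j
      by (metis column_def matrix_vector_mult_basis vec_lambda_beta zero_index)
    then have "P = 0" by (simp add: vec_eq_iff)
    then show ?thesis by (intro exI[of _ "[]"]) simp
  next
    case True
    then obtain i where i: "P $ i $ i \<noteq> 0" by blast
    define a where "a = P $ i $ i"
    have "0 \<le> a" using less.prems diag[of i P] unfolding pos_semidef_def a_def by metis
    with i have "0 < a" by (simp add: a_def)
    define v where "v = (1 / sqrt a) *\<^sub>R (P *v axis i 1)"
    define P' where "P' = P - outer_product v v"
    have sym: "transpose P = P" using less.prems by (simp add: pos_semidef_def)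
    have quad: "x \<bullet> (P' *v x) = x \<bullet> (P *v x) - (x \<bullet> (P *v axis i 1))\<^sup>2 / a" for x
      using \<open>0 < a\<close>
      by (simp add: P'_def mult_vec_linear_simps outer_product_mult_vec v_def inner_simps
          inner_commute[of _ x] power2_eq_square flip: real_sqrt_mult)
    have psd: "pos_semidef P'"
      unfolding pos_semidef_def
    proof safe
      show "transpose P' = P'"
        using sym by (simp add: P'_def transpose_linear_simps)
          (simp add: transpose_def outer_product_def vec_eq_iff mult_ac)
      fix x
      have "(x \<bullet> (P *v axis i 1))\<^sup>2 \<le> (x \<bullet> (P *v x)) * a"
        using psd_Cauchy_Schwarz[OF less.prems, of x "axis i 1"] diag[of i P] by (simp add: a_def)
      then show "0 \<le> x \<bullet> (P' *v x)"
        using \<open>0 < a\<close> by (simp add: quad divide_le_eq)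
    qed
    have "{j. P' $ j $ j \<noteq> 0} \<subset> {j. P $ j $ j \<noteq> 0}"
    proof (rule psubsetI)
      show "{j. P' $ j $ j \<noteq> 0} \<subseteq> {j. P $ j $ j \<noteq> 0}"
      proof safe
        fix j assume 0: "P' $ j $ j \<noteq> 0" "P $ j $ j = 0"
        have "0 \<le> P' $ j $ j" using psd diag[of j P'] unfolding pos_semidef_def by metis
        moreover have "P' $ j $ j = - (axis j 1 \<bullet> (P *v axis i 1))\<^sup>2 / a"
          using quad[of "axis j 1"] 0 by (simp add: diag)
        ultimately show False using 0 \<open>0 < a\<close> by (auto simp: divide_le_0_iff)
      qed
      have "P' $ i $ i = 0"
        using quad[of "axis i 1"] \<open>0 < a\<close> by (simp add: diag a_def power2_eq_square)
      then show "{j. P' $ j $ j \<noteq> 0} \<noteq> {j. P $ j $ j \<noteq> 0}" using i by blast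
    qed
    then have "card {j. P' $ j $ j \<noteq> 0} < card {j. P $ j $ j \<noteq> 0}"
      by (simp add: psubset_card_mono)
    from less.hyps[OF this psd] obtain vs where "P' = (\<Sum>v\<leftarrow>vs. outer_product v v)" by blast
    then have "P = (\<Sum>w\<leftarrow>v # vs. outer_product w w)" by (simp add: P'_def algebra_simps)
    then show ?thesis by blast
  qed
qed

text \<open>The trace of \<open>M\<close> against an outer product is the quadratic form of \<open>M\<close>, so the claim
  follows term by term from the Cholesky decomposition of \<open>P\<close>.\<close>

lemma trace_mult_psd_nonneg:
  fixes M P :: "real^'n^'n"
  assumes "\<And>x. 0 \<le> x \<bullet> (M *v x)" "pos_semidef P"
  shows "0 \<le> trace (M ** P)"
proof -
  obtain vs where vs: "P = (\<Sum>v\<leftarrow>vs. outer_product v v)"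
    using psd_sum_of_outer_products[OF assms(2)] by blast
  have "0 \<le> trace (M ** (\<Sum>v\<leftarrow>vs. outer_product v v))"
    by (induction vs)
      (simp_all add: matmul.zero_right matmul.add_right trace_linear_simps
        trace_mult_outer_product assms(1) trace_def[of 0] add_nonneg_nonneg)
  with vs show ?thesis by simp
qed

text \<open>Eigenvectors for distinct eigenvalues are orthogonal, hence independent. Finiteness is what
  gives the minimum in \<open>sigma_min\<close> its meaning.\<close>

lemma finite_eigenvalues_symmetric:
  fixes P :: "real^'n^'n"
  assumes sym: "transpose P = P"
  shows "finite (eigenvalues P)"
proof -
  have "\<forall>e \<in> eigenvalues P. \<exists>v. v \<noteq> 0 \<and> P *v v = e *\<^sub>R v"
    by (auto simp: eigenvalues_def scalar_mult_eq_scaleR)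
  from bchoice[OF this] obtain v
    where v: "\<And>e. e \<in> eigenvalues P \<Longrightarrow> v e \<noteq> 0 \<and> P *v v e = e *\<^sub>R v e"
    by blast
  have orth: "v e \<bullet> v f = 0" if "e \<in> eigenvalues P" "f \<in> eigenvalues P" "e \<noteq> f" for e f
  proof -
    have "e * (v e \<bullet> v f) = f * (v e \<bullet> v f)"
      using symmetric_inner_swap[OF sym, of "v e" "v f"] v[OF that(1)] v[OF that(2)]
      by (auto simp: inner_commute)
    with that(3) show ?thesis by auto
  qed
  have "inj_on v (eigenvalues P)"
    by (intro inj_onI) (metis inner_eq_zero_iff orth v)
  moreover have "finite (v ` eigenvalues P)"
  proof (rule independent_imp_finite, rule pairwise_orthogonal_independent)
    show "pairwise orthogonal (v ` eigenvalues P)"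
      unfolding pairwise_def orthogonal_def using orth by blast
    show "0 \<notin> v ` eigenvalues P" using v by fastforce
  qed
  ultimately show ?thesis by (simp add: finite_image_iff)
qed

text \<open>The minimum \<open>\<mu>\<close> of the quadratic form over the unit sphere is an eigenvalue: at a
  minimizer the form of \<open>P - \<mu> I\<close>, which is semidefinite, vanishes, and a semidefinite matrix kills
  such a vector.\<close>

lemma Rayleigh_minimizer:
  fixes P :: "real^'n^'n"
  assumes sym: "transpose P = P"
  shows "\<exists>\<mu> \<in> eigenvalues P. \<forall>x. \<mu> * (x \<bullet> x) \<le> x \<bullet> (P *v x)"
proof -
  have "continuous_on (sphere 0 1) (\<lambda>x. x \<bullet> (P *v x))"
    by (intro continuous_intros)
  then have "\<exists>v \<in> sphere 0 1. \<forall>x \<in> sphere 0 1. v \<bullet> (P *v v) \<le> x \<bullet> (P *v x)"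
    by (intro continuous_attains_inf) (auto simp: sphere_eq_empty)
  then obtain v where v: "v \<in> sphere 0 1" "\<And>x. x \<in> sphere 0 1 \<Longrightarrow> v \<bullet> (P *v v) \<le> x \<bullet> (P *v x)" by blast
  define \<mu> where "\<mu> = v \<bullet> (P *v v)"
  have vv: "v \<bullet> v = 1" using v(1) by (simp add: dot_square_norm)
  have low: "\<mu> * (x \<bullet> x) \<le> x \<bullet> (P *v x)" for x
  proof (cases "x = 0")
    case False
    have "\<mu> \<le> (inverse (norm x) *\<^sub>R x) \<bullet> (P *v (inverse (norm x) *\<^sub>R x))"
      using v(2)[of "inverse (norm x) *\<^sub>R x"] False by (simp add: \<mu>_def)
    also have "\<dots> = (x \<bullet> (P *v x)) / (x \<bullet> x)"
      using False by (simp add: matrix_vector_mult_scaleR dot_square_norm power2_eq_square divide_simps)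
    finally show ?thesis using False by (simp add: le_divide_eq)
  qed simp
  have shift: "(P - \<mu> *\<^sub>R mat 1) *v x = P *v x - \<mu> *\<^sub>R x" for x
    by (simp add: mult_vec_linear_simps)
  have "pos_semidef (P - \<mu> *\<^sub>R mat 1)"
    unfolding pos_semidef_def shift using low sym
    by (simp add: transpose_linear_simps inner_simps)
  moreover have "v \<bullet> ((P - \<mu> *\<^sub>R mat 1) *v v) = 0"
    unfolding shift using vv by (simp add: inner_simps \<mu>_def)
  ultimately have "P *v v = \<mu> *s v"
    using psd_null_vector shift by (metis eq_iff_diff_eq_0 scalar_mult_eq_scaleR)
  then have "\<mu> \<in> eigenvalues P"
    unfolding eigenvalues_def using vv by (metis (mono_tags, lifting) inner_zero_left mem_Collect_eq zero_neq_one)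
  with low show ?thesis by blast
qed

lemma sigma_min_le_quadratic_form:
  fixes P :: "real^'n^'n"
  assumes "transpose P = P"
  shows "sigma_min P * (x \<bullet> x) \<le> x \<bullet> (P *v x)"
proof -
  obtain \<mu> where \<mu>: "\<mu> \<in> eigenvalues P" "\<And>x. \<mu> * (x \<bullet> x) \<le> x \<bullet> (P *v x)"
    using Rayleigh_minimizer[OF assms] by blast
  have "sigma_min P \<le> \<mu>"
    unfolding sigma_min_def using finite_eigenvalues_symmetric[OF assms] \<mu>(1) by simp
  then have "sigma_min P * (x \<bullet> x) \<le> \<mu> * (x \<bullet> x)" by (simp add: mult_right_mono)
  with \<mu>(2) show ?thesis using order_trans by blast
qed

lemma sigma_min_pos:
  fixes P :: "real^'n^'n"
  assumes "pos_def P"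
  shows "0 < sigma_min P"
proof -
  have sym: "transpose P = P" using assms by (simp add: pos_def_def)
  have "sigma_min P \<in> eigenvalues P"
    unfolding sigma_min_def
    using finite_eigenvalues_symmetric[OF sym] Rayleigh_minimizer[OF sym] by (intro Min_in) auto
  then obtain v where "v \<noteq> 0" "P *v v = sigma_min P *\<^sub>R v"
    unfolding eigenvalues_def scalar_mult_eq_scaleR by blast
  with assms have "0 < sigma_min P * (v \<bullet> v)"
    unfolding pos_def_def by (metis inner_scaleR_right)
  then show ?thesis by (metis inner_ge_zero less_le_not_le zero_less_mult_iff)
qed

lemma sigma_min_norm_le:
  fixes P :: "real^'n^'n"
  assumes "transpose P = P"
  shows "sigma_min P * norm x \<le> norm (P *v x)"
proof (cases "x = 0")
  case False
  have "sigma_min P * norm x * norm x \<le> norm (P *v x) * norm x"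
    using sigma_min_le_quadratic_form[OF assms, of x] norm_cauchy_schwarz[of x "P *v x"]
    by (simp add: dot_square_norm power2_eq_square mult_ac)
  with False show ?thesis by simp
qed simp

section \<open>Norms of matrix products\<close>

lemma norm_mult_vec_le_spectral_norm: "norm (M *v x) \<le> spectral_norm M * norm x"
  for M :: "real^'n^'m"
  unfolding spectral_norm_def by (rule onorm) simp

lemma spectral_norm_nonneg: "0 \<le> spectral_norm (M :: real^'n^'m)"
  unfolding spectral_norm_def by (rule onorm_pos_le) simp

lemma row_matrix_mult_transpose: "(X ** transpose Y) $ i = Y *v (X $ i)"
  for X :: "real^'n^'m" and Y :: "real^'n^'k"
  by (simp add: matrix_matrix_mult_def transpose_def matrix_vector_mult_def vec_eq_iff mult_ac)

lemma norm_le_by_rows: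
  fixes X :: "real^'n^'m" and Y :: "real^'k^'m"
  assumes "\<And>i. a * norm (X $ i) \<le> norm (Y $ i)" "0 \<le> a"
  shows "a * norm X \<le> norm Y"
proof -
  have "a * norm X = L2_set (\<lambda>i. a * norm (X $ i)) UNIV"
    using assms(2) by (simp add: norm_vec_def L2_set_right_distrib)
  also have "\<dots> \<le> L2_set (\<lambda>i. norm (Y $ i)) UNIV"
    using assms by (intro L2_set_mono) auto
  finally show ?thesis by (simp add: norm_vec_def)
qed

lemma norm_mult_transpose_le: "norm (X ** transpose Y) \<le> spectral_norm Y * norm X"
  for X :: "real^'n^'m" and Y :: "real^'n^'k"
proof -
  have "norm (X ** transpose Y) = L2_set (\<lambda>i. norm (Y *v (X $ i))) UNIV"
    by (simp add: norm_vec_def[of "X ** transpose Y"] row_matrix_mult_transpose)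
  also have "\<dots> \<le> L2_set (\<lambda>i. spectral_norm Y * norm (X $ i)) UNIV"
    by (intro L2_set_mono) (auto simp: norm_mult_vec_le_spectral_norm)
  also have "\<dots> = spectral_norm Y * norm X"
    by (simp add: norm_vec_def[of X] L2_set_right_distrib spectral_norm_nonneg)
  finally show ?thesis .
qed

lemma sigma_min_norm_mult_le:
  fixes X :: "real^'n^'m" and P :: "real^'n^'n"
  assumes "transpose P = P" "0 \<le> sigma_min P"
  shows "sigma_min P * norm X \<le> norm (X ** P)"
  using assms row_matrix_mult_transpose[of X P] sigma_min_norm_le[OF assms(1)]
  by (intro norm_le_by_rows) simp_all

lemma norm_mult_vec_le: "norm (M *v x) \<le> norm M * norm x"
  for M :: "real^'n^'m"
proof -
  have "norm (M *v x) = L2_set (\<lambda>i. norm (M $ i \<bullet> x)) UNIV"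
    by (simp add: norm_vec_def[of "M *v x"] matrix_vector_mul_component)
  also have "\<dots> \<le> L2_set (\<lambda>i. norm x * norm (M $ i)) UNIV"
    by (intro L2_set_mono) (simp_all add: mult.commute[of "norm x"] Cauchy_Schwarz_ineq2)
  also have "\<dots> = norm M * norm x"
    by (simp add: norm_vec_def[of M] L2_set_right_distrib mult.commute)
  finally show ?thesis .
qed

lemma norm_transpose: "norm (transpose M) = norm M" for M :: "real^'n^'m"
  unfolding norm_eq_sqrt_inner inner_matrix_eq_trace
  by (simp only: transpose_transpose trace_mul_sym[of "transpose M" M])

lemma norm_matrix_mult_le: "norm (X ** Y) \<le> norm X * norm Y"
  for X :: "real^'n^'m" and Y :: "real^'k^'n"
proof -
  have row: "(X ** Y) $ i = transpose Y *v (X $ i)" for i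
    using row_matrix_mult_transpose[of X "transpose Y" i] by simp
  have "norm (X ** Y) = L2_set (\<lambda>i. norm (transpose Y *v (X $ i))) UNIV"
    by (simp only: norm_vec_def[of "X ** Y"] row)
  also have "\<dots> \<le> L2_set (\<lambda>i. norm Y * norm (X $ i)) UNIV"
    using norm_mult_vec_le[of "transpose Y"] norm_transpose[of Y] by (intro L2_set_mono) auto
  also have "\<dots> = norm X * norm Y"
    by (simp add: norm_vec_def[of X] L2_set_right_distrib mult.commute)
  finally show ?thesis .
qed

section \<open>Spectral radius and stability\<close>

definition complexify :: "real^'n^'m \<Rightarrow> complex^'n^'m" where
  "complexify M = (\<chi> i j. complex_of_real (M $ i $ j))"

lemma complexify_mult: "complexify (X ** Y) = complexify X ** complexify Y"
  by (simp add: complexify_def matrix_matrix_mult_def vec_eq_iff)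

lemma complexify_mat_1: "complexify (mat 1) = mat 1"
  by (simp add: complexify_def mat_def vec_eq_iff)

lemma matpow_0: "matpow A 0 = mat 1"
  and matpow_Suc: "matpow A (Suc k) = A ** matpow A k"
  by (simp_all add: matpow_def)

primrec matpow_vec :: "complex^'n^'n \<Rightarrow> nat \<Rightarrow> complex^'n \<Rightarrow> complex^'n" where
  "matpow_vec T 0 v = v"
| "matpow_vec T (Suc k) v = T *v matpow_vec T k v"

lemma matpow_vec_complexify: "matpow_vec (complexify A) k v = complexify (matpow A k) *v v"
  by (induction k) (simp_all add: matpow_0 matpow_Suc complexify_mult complexify_mat_1
      matrix_vector_mul_assoc)

lemma matpow_vec_diff: "matpow_vec T k (v - w) = matpow_vec T k v - matpow_vec T k w"
  by (induction k) (simp_all add: matrix_vector_mult_diff_distrib)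

lemma matpow_vec_scale: "matpow_vec T k (c *s v) = c *s matpow_vec T k v"
  by (induction k) (simp_all add: vec.scale)

lemma matpow_vec_mult: "matpow_vec T k (T *v v) = matpow_vec T (Suc k) v"
  by (induction k) simp_all

text \<open>The vector \<open>p(T) v\<close>, by the Horner scheme.\<close>

definition poly_vec :: "complex^'n^'n \<Rightarrow> complex poly \<Rightarrow> complex^'n \<Rightarrow> complex^'n" where
  "poly_vec T p v = fold_coeffs (\<lambda>a w. a *s v + T *v w) p 0"

lemma poly_vec_0 [simp]: "poly_vec T 0 v = 0"
  by (simp add: poly_vec_def)

lemma poly_vec_pCons [simp]: "poly_vec T (pCons a p) v = a *s v + T *v poly_vec T p v"
  by (cases "p = 0 \<and> a = 0") (auto simp: poly_vec_def)

lemma poly_vec_add: "poly_vec T (p + q) v = poly_vec T p v + poly_vec T q v"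
  by (induction p q rule: poly_induct2)
    (simp_all add: vec.scale_left_distrib matrix_vector_right_distrib)

lemma poly_vec_smult: "poly_vec T (smult c p) v = c *s poly_vec T p v"
  by (induction p) (simp_all add: vec.scale_right_distrib vec.scale)

lemma poly_vec_mult: "poly_vec T (p * q) v = poly_vec T p (poly_vec T q v)"
  by (induction p) (simp_all add: poly_vec_add poly_vec_smult)

lemma poly_vec_monom: "poly_vec T (monom c k) v = c *s matpow_vec T k v"
  by (induction k) (simp_all add: monom_0 monom_Suc vec.scale)

lemma poly_vec_sum: "poly_vec T (\<Sum>i\<in>I. p i) v = (\<Sum>i\<in>I. poly_vec T (p i) v)"
  by (induction I rule: infinite_finite_induct) (simp_all add: poly_vec_add)

lemma poly_vec_eigenvector:
  assumes "T *v v = e *s v"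
  shows "poly_vec T p v = poly p e *s v"
  by (induction p) (simp_all add: assms vec.scale vec.scale_left_distrib mult_ac)

text \<open>The powers of \<open>A\<close> live in a finite-dimensional space, so more of them than the dimension
  satisfy a linear relation. The relation is found over the reals, and used over the complex
  numbers, where the polynomial splits.\<close>

lemma annihilating_polynomial:
  fixes A :: "real^'n^'n"
  obtains p where "p \<noteq> 0" "\<And>v. poly_vec (complexify A) p v = 0"
proof -
  define N where "N = Suc DIM(real^'n^'n)"
  have "\<exists>c :: nat \<Rightarrow> real. (\<exists>i<N. c i \<noteq> 0) \<and> (\<Sum>i<N. c i *\<^sub>R matpow A i) = 0"
  proof (cases "inj_on (matpow A) {..<N}")
    case True
    have card: "card (matpow A ` {..<N}) = N" using True by (simp add: card_image)
    have "dependent (matpow A ` {..<N})"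
      using independent_bound_general[of "matpow A ` {..<N}"] card dim_subset_UNIV[of "matpow A ` {..<N}"]
      by (auto simp: N_def)
    then obtain u where u: "\<exists>X \<in> matpow A ` {..<N}. u X \<noteq> 0"
      "(\<Sum>X \<in> matpow A ` {..<N}. u X *\<^sub>R X) = 0"
      using dependent_finite[of "matpow A ` {..<N}"] by blast
    then show ?thesis
      using True by (intro exI[of _ "\<lambda>i. u (matpow A i)"]) (auto simp: sum.reindex)
  next
    case False
    \<comment> \<open>a repeated power is annihilated by \<open>x^i - x^j\<close>\<close>
    then obtain i j where ij: "i < N" "j < N" "i \<noteq> j" "matpow A i = matpow A j"
      by (auto simp: inj_on_def)
    have "(\<Sum>k<N. ((if k = i then 1 else 0) - (if k = j then 1 else 0)) *\<^sub>R matpow A k)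
      = (\<Sum>k<N. if k = i then matpow A k else 0) - (\<Sum>k<N. if k = j then matpow A k else 0)"
      unfolding sum_subtractf[symmetric] by (intro sum.cong) auto
    also have "\<dots> = 0" using ij by (simp add: sum.delta)
    finally show ?thesis
      using ij by (intro exI[of _ "\<lambda>k. (if k = i then 1 else 0) - (if k = j then 1 else 0)"]) auto
  qed
  then obtain c i where c: "i < N" "c i \<noteq> 0" "(\<Sum>i<N. c i *\<^sub>R matpow A i) = 0" by blast
  define p where "p = (\<Sum>i<N. monom (complex_of_real (c i)) i)"
  have "coeff p i = of_real (c i)"
    using c(1) by (simp add: p_def coeff_sum if_distrib sum.delta)
  with c(2) have "p \<noteq> 0" by auto
  moreover have "poly_vec (complexify A) p v = 0" for v
  proof -
    have "poly_vec (complexify A) p v = (\<Sum>i<N. complexify (c i *\<^sub>R matpow A i) *v v)"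
      unfolding p_def poly_vec_sum poly_vec_monom matpow_vec_complexify
      by (intro sum.cong) (simp_all add: complexify_def matrix_vector_mult_def vec_eq_iff
          sum_distrib_left mult_ac)
    also have "\<dots> = complexify (\<Sum>i<N. c i *\<^sub>R matpow A i) *v v"
      by (simp add: complexify_def matrix_vector_mult_def vec_eq_iff sum_distrib_right
          sum.swap[of _ UNIV])
    finally show ?thesis
      using c(3) by (simp add: complexify_def matrix_vector_mult_def vec_eq_iff)
  qed
  ultimately show thesis using that by blast
qed

text \<open>Every eigenvalue is a root of the annihilating polynomial. Finiteness is what gives the
  maximum in \<open>spectral_radius\<close> its meaning.\<close>

lemma finite_eigenvalues_complexify: "finite (eigenvalues (complexify (A :: real^'n^'n)))"
proof -
  obtain p where p: "p \<noteq> 0" "\<And>v. poly_vec (complexify A) p v = 0"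
    using annihilating_polynomial by blast
  have "eigenvalues (complexify A) \<subseteq> {e. poly p e = 0}"
  proof
    fix e assume "e \<in> eigenvalues (complexify A)"
    then obtain v where "v \<noteq> 0" "complexify A *v v = e *s v"
      unfolding eigenvalues_def by blast
    then show "e \<in> {e. poly p e = 0}"
      using poly_vec_eigenvector[of "complexify A" v e p] p(2) by simp
  qed
  then show ?thesis using poly_roots_finite[OF p(1)] finite_subset by blast
qed

lemma contracting_recurrence_tendsto_0:
  fixes x w :: "nat \<Rightarrow> 'a :: real_normed_vector"
  assumes rec: "\<And>k. norm (x (Suc k)) \<le> r * norm (x k) + norm (w k)" and "0 \<le> r" "r < 1"
    and w: "w \<longlonglongrightarrow> 0"
  shows "x \<longlonglongrightarrow> 0"
proof (rule LIMSEQ_I)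
  fix e :: real assume "0 < e"
  \<comment> \<open>perturbations below \<open>d\<close> accumulate to at most \<open>d / (1 - r) = e / 2\<close>\<close>
  define d where "d = (1 - r) * e / 2"
  have "0 < d" using \<open>0 < e\<close> \<open>r < 1\<close> by (simp add: d_def)
  then obtain N where N: "\<And>k. N \<le> k \<Longrightarrow> norm (w k) < d"
    using LIMSEQ_D[OF w] by auto
  have bound: "norm (x (N + k)) \<le> r ^ k * norm (x N) + e / 2" for k
  proof (induction k)
    case 0 show ?case using \<open>0 < e\<close> by simp
  next
    case (Suc k)
    have "norm (x (N + Suc k)) \<le> r * norm (x (N + k)) + d"
      using rec[of "N + k"] N[of "N + k"] by simp
    also have "\<dots> \<le> r * (r ^ k * norm (x N) + e / 2) + d"
      using Suc.IH \<open>0 \<le> r\<close> by (simp add: mult_left_mono)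
    also have "\<dots> = r ^ Suc k * norm (x N) + e / 2" by (simp add: d_def field_simps)
    finally show ?case .
  qed
  have "(\<lambda>k. r ^ k * norm (x N)) \<longlonglongrightarrow> 0"
    using \<open>0 \<le> r\<close> \<open>r < 1\<close> by (intro tendsto_mult_left_zero LIMSEQ_realpow_zero)
  then obtain L where L: "\<And>k. L \<le> k \<Longrightarrow> \<bar>r ^ k * norm (x N)\<bar> < e / 2"
    using LIMSEQ_D[of _ 0 "e / 2"] \<open>0 < e\<close> by (metis diff_zero half_gt_zero real_norm_def)
  have "norm (x k - 0) < e" if "N + L \<le> k" for k
  proof -
    have "\<bar>r ^ (k - N) * norm (x N)\<bar> < e / 2" using that by (intro L) simp
    then show ?thesis using bound[of "k - N"] that by simp
  qed
  then show "\<exists>no. \<forall>k\<ge>no. norm (x k - 0) < e" by blast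
qed

lemma norm_scale_vec: "norm (c *s v) = cmod c * norm v"
  by (simp add: norm_vec_def norm_mult L2_set_right_distrib)

text \<open>Induction on the degree of \<open>p\<close>. Splitting off a root \<open>z\<close> of \<open>p\<close>, the vector
  \<open>w = (T - z) v\<close> is annihilated by a polynomial of smaller degree, so \<open>T^k w\<close> tends to \<open>0\<close>. If
  \<open>\<bar>z\<bar> < 1\<close>, then \<open>T^(k+1) v = z T^k v + T^k w\<close> is a contracting recurrence. Otherwise \<open>z\<close> is no
  eigenvalue by assumption, and \<open>T^k v = (T - z)^(-1) T^k w\<close>.\<close>

lemma matpow_vec_tendsto_0:
  assumes ev: "\<And>e. e \<in> eigenvalues T \<Longrightarrow> cmod e < 1"
    and "p \<noteq> 0" "poly_vec T p v = 0"
  shows "(\<lambda>k. matpow_vec T k v) \<longlonglongrightarrow> 0"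
  using assms(2-)
proof (induction "degree p" arbitrary: p v)
  case 0
  then obtain a where "p = [:a:]" by (metis degree_eq_zeroE)
  with 0 have "v = 0" by simp
  moreover have "matpow_vec T k 0 = 0" for k by (induction k) simp_all
  ultimately show ?case by simp
next
  case (Suc n)
  then have "\<not> constant (poly p)" by (simp add: constant_degree)
  then obtain z where "poly p z = 0" using fundamental_theorem_of_algebra by blast
  then obtain q where q: "p = q * [:- z, 1:]" by (metis dvdE mult.commute poly_eq_0_iff_dvd)
  with Suc.prems have "q \<noteq> 0" by auto
  with q Suc.hyps(2) have deg: "n = degree q"
    using degree_mult_eq[of q "[:- z, 1:]"] by simp
  define w where "w = T *v v - z *s v"
  have w': "poly_vec T [:- z, 1:] v = w" by (simp add: w_def)
  have w0: "(\<lambda>k. matpow_vec T k w) \<longlonglongrightarrow> 0"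
    using Suc.hyps(1)[OF deg \<open>q \<noteq> 0\<close>] Suc.prems(2) unfolding q poly_vec_mult w' by blast
  show ?case
  proof (cases "cmod z < 1")
    case True
    have "matpow_vec T (Suc k) v = z *s matpow_vec T k v + matpow_vec T k w" for k
      unfolding w_def matpow_vec_diff matpow_vec_mult matpow_vec_scale by simp
    then have "norm (matpow_vec T (Suc k) v) \<le> cmod z * norm (matpow_vec T k v) + norm (matpow_vec T k w)" for k
      by (metis norm_scale_vec norm_triangle_ineq)
    then show ?thesis
      using contracting_recurrence_tendsto_0[OF _ _ True w0] by simp
  next
    case False
    then have "z \<notin> eigenvalues T" using ev by blast
    define Z where "Z = T - mat z"
    have Z: "Z *v u = T *v u - z *s u" for u
      unfolding Z_def matrix_vector_mult_diff_rdistrib by (simp add: mat_def matrix_vector_mult_def vec_eq_iff if_distrib[of "\<lambda>c. c * _"] cong: if_cong)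
    have "\<forall>u. Z *v u = 0 \<longrightarrow> u = 0"
      using \<open>z \<notin> eigenvalues T\<close> unfolding Z eigenvalues_def by auto
    then obtain Y where Y: "Y ** Z = mat 1"
      using matrix_left_invertible_ker by blast
    have "matpow_vec T k w = Z *v matpow_vec T k v" for k
      unfolding w_def matpow_vec_diff matpow_vec_mult matpow_vec_scale Z by simp
    then have "matpow_vec T k v = Y *v matpow_vec T k w" for k
      using Y by (simp add: matrix_vector_mul_assoc)
    moreover have "(\<lambda>k. Y *v matpow_vec T k w) \<longlonglongrightarrow> Y *v 0"
      by (intro bounded_linear.tendsto[OF matrix_vector_mul_bounded_linear] w0)
    ultimately show ?thesis by simp
  qed
qed

text \<open>Stability is expressed through powers because a Stein equation \<open>X = W + A X A^T\<close> can be
  iterated and the remainder \<open>A^k X (A^k)^T\<close> then vanishes in the limit.\<close>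

definition schur_stable :: "real^'n^'n \<Rightarrow> bool" where
  "schur_stable A \<longleftrightarrow> (\<lambda>k. matpow A k) \<longlonglongrightarrow> 0"

lemma spectral_radius_less_1_imp_schur_stable:
  assumes "spectral_radius A < 1"
  shows "schur_stable A"
proof -
  have ev: "cmod e < 1" if "e \<in> eigenvalues (complexify A)" for e
  proof -
    have "cmod e \<le> spectral_radius A"
      unfolding spectral_radius_def using that finite_eigenvalues_complexify[of A]
      by (intro Max_ge) (auto simp: complexify_def)
    with assms show ?thesis by simp
  qed
  obtain p where p: "p \<noteq> 0" "\<And>v. poly_vec (complexify A) p v = 0"
    using annihilating_polynomial by blast
  have "(\<lambda>k. matpow A k $ i $ j) \<longlonglongrightarrow> 0" for i j
  proof -
    have "(\<lambda>k. complexify (matpow A k) *v axis j 1) \<longlonglongrightarrow> 0"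
      using matpow_vec_tendsto_0[OF ev p] by (simp add: matpow_vec_complexify)
    from tendsto_vec_nth[OF this, of i] have "(\<lambda>k. complex_of_real (matpow A k $ i $ j)) \<longlonglongrightarrow> 0"
      by (simp add: complexify_def matrix_vector_mult_def axis_def if_distrib cong: if_cong)
    then show ?thesis using tendsto_of_real_iff[where 'a = complex] of_real_0 by metis
  qed
  then show ?thesis
    unfolding schur_stable_def by (intro vec_tendstoI) simp
qed

section \<open>Stein equations\<close>

lemma matpow_Suc_right: "matpow A (Suc k) = matpow A k ** A"
proof (induction k)
  case (Suc k)
  have "matpow A (Suc (Suc k)) = A ** (matpow A k ** A)"
    unfolding matpow_Suc[of A "Suc k"] Suc.IH ..
  then show ?case by (simp add: matpow_Suc matrix_mul_assoc)
qed (simp add: matpow_0 matpow_Suc)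

lemma matpow_transpose: "matpow (transpose A) k = transpose (matpow A k)"
  by (induction k) (simp_all only: matpow_0 transpose_mat matpow_Suc_right[of A]
      matpow_Suc[of "transpose A"] matrix_transpose_mul)

lemma schur_stable_transpose: "schur_stable A \<Longrightarrow> schur_stable (transpose A)"
  unfolding schur_stable_def matpow_transpose
  using bounded_linear.tendsto_zero[OF bounded_linear_transpose] by blast

lemma schur_stable_trajectory: "schur_stable A \<Longrightarrow> (\<lambda>k. matpow A k *v x) \<longlonglongrightarrow> 0"
  unfolding schur_stable_def using bounded_linear.tendsto_zero[OF bounded_linear_mult_vec] by blast

text \<open>Iterating the equation gives \<open>X = A^k X (A^k)^T\<close> for every \<open>k\<close>, and the right-hand
  side tends to \<open>0\<close>.\<close>

lemma stein_homogeneous_unique: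
  assumes stable: "schur_stable A" and X: "X = A ** X ** transpose A"
  shows "X = 0"
proof -
  have unroll: "X = matpow A k ** X ** transpose (matpow A k)" for k
  proof (induction k)
    case (Suc k)
    have "matpow A (Suc k) ** X ** transpose (matpow A (Suc k))
      = matpow A k ** (A ** X ** transpose A) ** transpose (matpow A k)"
      unfolding matpow_Suc_right matrix_transpose_mul by (simp only: matrix_mul_assoc)
    also have "\<dots> = X" by (simp only: X[symmetric] Suc.IH[symmetric])
    finally show ?case ..
  qed (simp add: matpow_0)
  then have eq: "(\<lambda>k. matpow A k ** X ** transpose (matpow A k)) = (\<lambda>k. X)"
    by (intro ext) (rule sym)
  have "(\<lambda>k. matpow A k ** X ** transpose (matpow A k)) \<longlonglongrightarrow> 0 ** X ** transpose 0"
    using stable unfolding schur_stable_def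
    by (intro matmul.tendsto tendsto_const bounded_linear.tendsto[OF bounded_linear_transpose])
  then have "(\<lambda>k :: nat. X) \<longlonglongrightarrow> 0" unfolding eq matmul.zero_left .
  from LIMSEQ_unique[OF tendsto_const this] show ?thesis .
qed

lemma linear_stein: "linear (\<lambda>X :: real^'n^'n. X - A ** X ** transpose A)"
  by (intro linearI) (simp_all add: matrix_linear_simps algebra_simps)

lemma inj_stein:
  assumes "schur_stable A"
  shows "inj (\<lambda>X. X - A ** X ** transpose A)"
  using linear_injective_0[OF linear_stein[of A]] stein_homogeneous_unique[OF assms] by auto

text \<open>On a finite-dimensional space an injective linear operator is surjective, so existence
  follows from uniqueness, without summing the series of \<open>A^k W (A^k)^T\<close>.\<close>

lemma stein_ex1:
  assumes "schur_stable A"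
  shows "\<exists>!X. X = W + A ** X ** transpose A"
proof -
  have "surj (\<lambda>X. X - A ** X ** transpose A)"
    using linear_injective_imp_surjective linear_stein inj_stein[OF assms] by blast
  then obtain X where X: "X - A ** X ** transpose A = W" unfolding surj_def by metis
  show ?thesis
  proof (rule ex1I)
    show "X = W + A ** X ** transpose A" by (rule diff_eq_eq[THEN iffD1, OF X])
    fix Y assume "Y = W + A ** Y ** transpose A"
    then have "Y - A ** Y ** transpose A = W" by (rule diff_eq_eq[THEN iffD2])
    with X show "Y = X" using injD[OF inj_stein[OF assms], of Y X] by simp
  qed
qed

text \<open>Symmetry follows from uniqueness, as the transpose of \<open>X\<close> solves the same equation. Along the
  dual trajectory \<open>y\<^sub>k = (A^T)^k x\<close> the form \<open>y\<^sub>k \<bullet> X y\<^sub>k\<close> does not increase, by the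
  equation, and tends to \<open>0\<close>, so its first value is nonnegative.\<close>

lemma stein_psd:
  assumes stable: "schur_stable A" and X: "X = W + A ** X ** transpose A" and W: "pos_semidef W"
  shows "pos_semidef X"
  unfolding pos_semidef_def
proof safe
  have "transpose X = transpose (W + A ** X ** transpose A)" by (subst X) (rule refl)
  also have "\<dots> = W + A ** transpose X ** transpose A"
    using W by (simp add: pos_semidef_def transpose_linear_simps matrix_transpose_mul matrix_mul_assoc)
  finally show "transpose X = X" using X stein_ex1[OF stable, of W] by blast
  fix x
  let ?y = "\<lambda>k. matpow (transpose A) k *v x"
  have step: "?y k \<bullet> (X *v ?y k) = ?y k \<bullet> (W *v ?y k) + ?y (Suc k) \<bullet> (X *v ?y (Suc k))" for k
  proof -
    have "?y k \<bullet> (X *v ?y k) = ?y k \<bullet> ((W + A ** X ** transpose A) *v ?y k)"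
      by (subst X[symmetric]) (rule refl)
    then show ?thesis
      unfolding mult_vec_linear_simps inner_add_right matpow_Suc
      by (metis inner_transpose_mult matrix_vector_mul_assoc transpose_transpose)
  qed
  have "?y k \<bullet> (X *v ?y k) \<le> x \<bullet> (X *v x)" for k
  proof (induction k)
    case (Suc k)
    have "0 \<le> ?y k \<bullet> (W *v ?y k)" using W by (simp add: pos_semidef_def)
    with Suc step[of k] show ?case by linarith
  qed (simp add: matpow_0)
  moreover have "(\<lambda>k. ?y k \<bullet> (X *v ?y k)) \<longlonglongrightarrow> 0 \<bullet> (X *v 0)"
    by (intro tendsto_intros bounded_linear.tendsto[OF matrix_vector_mul_bounded_linear]
        schur_stable_trajectory schur_stable_transpose stable)
  ultimately show "0 \<le> x \<bullet> (X *v x)"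
    by (intro LIMSEQ_le_const2[of _ 0]) auto
qed

text \<open>Summing the decrease along a trajectory bounds \<open>\<Sum>\<^sub>k \<bar>A^k x\<bar>\<^sup>2\<close> by
  \<open>x \<bullet> P x / c\<close>, so its terms tend to \<open>0\<close>.\<close>

lemma schur_stable_by_Lyapunov_function:
  assumes P: "pos_semidef P" and "0 < c"
    and decrease: "\<And>x. c * (x \<bullet> x) + (A *v x) \<bullet> (P *v (A *v x)) \<le> x \<bullet> (P *v x)"
  shows "schur_stable A"
proof -
  have traj: "(\<lambda>k. matpow A k *v x) \<longlonglongrightarrow> 0" for x
  proof -
    let ?x = "\<lambda>k. matpow A k *v x"
    have "c * (\<Sum>k<n. ?x k \<bullet> ?x k) + ?x n \<bullet> (P *v ?x n) \<le> x \<bullet> (P *v x)" for n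
    proof (induction n)
      case (Suc n)
      then show ?case
        using decrease[of "?x n"] by (simp add: matpow_Suc matrix_vector_mul_assoc distrib_left)
    qed (simp add: matpow_0)
    moreover have "0 \<le> ?x n \<bullet> (P *v ?x n)" for n using P by (simp add: pos_semidef_def)
    ultimately have "(\<Sum>k<n. ?x k \<bullet> ?x k) \<le> (x \<bullet> (P *v x)) / c" for n
      using \<open>0 < c\<close> by (simp add: pos_le_divide_eq mult.commute) (smt (verit))
    then have "summable (\<lambda>k. ?x k \<bullet> ?x k)"
      by (intro summableI_nonneg_bounded) auto
    then have "(\<lambda>k. sqrt (?x k \<bullet> ?x k)) \<longlonglongrightarrow> sqrt 0"
      by (intro tendsto_real_sqrt summable_LIMSEQ_zero)
    then show ?thesis by (simp add: norm_eq_sqrt_inner[symmetric] tendsto_norm_zero_iff)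
  qed
  have "(\<lambda>k. matpow A k $ i $ j) \<longlonglongrightarrow> 0" for i j
    using tendsto_vec_nth[OF traj[of "axis j 1"], of i]
    by (simp add: matrix_vector_mult_basis column_def)
  then show ?thesis
    unfolding schur_stable_def by (intro vec_tendstoI) simp
qed

text \<open>A Lyapunov function for \<open>A\<close>, normalized to decrease by \<open>x \<bullet> x\<close>, still decreases by half of
  that for all matrices near \<open>A\<close>.\<close>

lemma eventually_schur_stable:
  fixes A :: "real^'n^'n"
  assumes "schur_stable A"
  shows "eventually schur_stable (nhds A)"
proof -
  obtain P where P0: "P = mat 1 + transpose A ** P ** transpose (transpose A)"
    using stein_ex1[OF schur_stable_transpose[OF assms], of "mat 1"] by blast
  have P: "pos_semidef P"
    using stein_psd[OF schur_stable_transpose[OF assms] P0] by (simp add: pos_semidef_def)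
  define N where "N A' = P - transpose A' ** P ** A' - mat 1" for A'
  have N0: "N A = 0" by (simp only: N_def diff_diff_eq) (metis P0 add.commute diff_self transpose_transpose)
  have "(N \<longlongrightarrow> N A) (nhds A)"
    unfolding N_def
    by (intro tendsto_intros matmul.tendsto bounded_linear.tendsto[OF bounded_linear_transpose]
        filterlim_ident)
  then have "eventually (\<lambda>A'. dist (N A') 0 < 1/2) (nhds A)"
    unfolding N0 by (rule tendstoD) simp
  then show ?thesis
  proof eventually_elim
    case (elim A')
    show "schur_stable A'"
    proof (rule schur_stable_by_Lyapunov_function[OF P, of "1/2"])
      fix x
      have "x \<bullet> (N A' *v x) = x \<bullet> (P *v x) - (A' *v x) \<bullet> (P *v (A' *v x)) - x \<bullet> x"
        unfolding N_def mult_vec_linear_simps inner_diff_right matrix_mult_assoc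
        by (simp only: matrix_vector_mul_assoc[symmetric] inner_transpose_mult matrix_vector_mul_lid)
      moreover have "\<bar>x \<bullet> (N A' *v x)\<bar> \<le> 1/2 * (x \<bullet> x)"
      proof -
        have "\<bar>x \<bullet> (N A' *v x)\<bar> \<le> norm x * norm (N A' *v x)" by (rule Cauchy_Schwarz_ineq2)
        also have "\<dots> \<le> norm x * (1/2 * norm x)"
          using elim by (intro mult_left_mono order_trans[OF norm_mult_vec_le] mult_right_mono) auto
        finally show ?thesis by (simp add: dot_square_norm power2_eq_square)
      qed
      ultimately show "1/2 * (x \<bullet> x) + (A' *v x) \<bullet> (P *v (A' *v x)) \<le> x \<bullet> (P *v x)" by linarith
    qed simp
  qed
qed

text \<open>The Stein operator of \<open>A\<close> is bounded below by some \<open>m > 0\<close>, and for \<open>A'\<close> near \<open>A\<close> the two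
  operators differ by a small multiple \<open>\<epsilon> A'\<close> of the norm. Comparing the two solutions gives
  \<open>(m - \<epsilon> A') \<bar>X A' - X A\<bar> \<le> \<epsilon> A' \<bar>X A\<bar>\<close>.\<close>

lemma stein_solution_tendsto:
  fixes A :: "real^'n^'n"
  assumes stable: "schur_stable A"
    and X: "\<And>A'. schur_stable A' \<Longrightarrow> X A' = W + A' ** X A' ** transpose A'"
  shows "(X \<longlongrightarrow> X A) (nhds A)"
proof -
  obtain m where "0 < m" and m: "\<And>Z. m * norm Z \<le> norm (Z - A ** Z ** transpose A)"
    using linear_inj_bounded_below_pos[OF linear_stein[of A] inj_stein[OF stable]] by blast
  define \<epsilon> where "\<epsilon> A' = norm (A' - A) * norm A' + norm A * norm (A' - A)" for A'
  have "(\<epsilon> \<longlongrightarrow> norm (A - A) * norm A + norm A * norm (A - A)) (nhds A)"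
    unfolding \<epsilon>_def by (intro tendsto_intros filterlim_ident)
  then have \<epsilon>0: "(\<epsilon> \<longlongrightarrow> 0) (nhds A)" by simp
  have "eventually (\<lambda>A'. dist (\<epsilon> A') 0 < m / 2) (nhds A)"
    using \<open>0 < m\<close> by (intro tendstoD[OF \<epsilon>0]) simp
  with eventually_schur_stable[OF stable]
  have "eventually (\<lambda>A'. norm (X A' - X A) \<le> \<epsilon> A' * (2 * norm (X A) / m)) (nhds A)"
  proof eventually_elim
    case (elim A')
    define Z where "Z = X A' - X A"
    have "Z - A ** Z ** transpose A
      = (X A' - A' ** X A' ** transpose A') - (X A - A ** X A ** transpose A)
        + (A' ** X A' ** transpose A' - A ** X A' ** transpose A)"
      by (simp add: Z_def matrix_linear_simps)
    also have "\<dots> = A' ** X A' ** transpose A' - A ** X A' ** transpose A"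
      using diff_eq_eq[THEN iffD2, OF X[OF elim(1)]] diff_eq_eq[THEN iffD2, OF X[OF stable]]
      by simp
    also have "\<dots> = (A' - A) ** X A' ** transpose A' + A ** X A' ** transpose (A' - A)"
      by (simp add: matrix_linear_simps transpose_linear_simps)
    also have "norm \<dots> \<le> norm (A' - A) * norm (X A') * norm A' + norm A * norm (X A') * norm (A' - A)"
      by (intro norm_triangle_mono order_trans[OF norm_matrix_mult_le] mult_mono norm_matrix_mult_le)
        (simp_all add: norm_transpose)
    also have "\<dots> = \<epsilon> A' * norm (Z + X A)" by (simp add: \<epsilon>_def Z_def algebra_simps)
    also have "\<dots> \<le> \<epsilon> A' * (norm Z + norm (X A))"
      by (intro mult_left_mono norm_triangle_ineq) (simp add: \<epsilon>_def)
    finally have "m * norm Z \<le> \<epsilon> A' * norm Z + \<epsilon> A' * norm (X A)"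
      using m[of Z] by (simp add: distrib_left)
    also have "\<dots> \<le> m / 2 * norm Z + \<epsilon> A' * norm (X A)"
      using elim(2) by (intro add_right_mono mult_right_mono) auto
    finally show ?case using \<open>0 < m\<close> by (simp add: Z_def field_simps)
  qed
  then have "((\<lambda>A'. X A' - X A) \<longlongrightarrow> 0) (nhds A)"
    by (rule Lim_null_comparison) (rule tendsto_mult_left_zero[OF \<epsilon>0])
  then show ?thesis by (simp add: LIM_zero_iff)
qed

section \<open>Comparison of the costs of two gains\<close>

text \<open>The operators \<open>D \<mapsto> D - A^T D A\<close> and \<open>X \<mapsto> X - A X A^T\<close> are adjoint with respect to
  the trace pairing. This turns a comparison of values into an integral against the state
  covariance.\<close>

lemma trace_stein_duality:
  fixes A D X :: "real^'n^'n"
  assumes "D = G + transpose A ** D ** A" "X = W + A ** X ** transpose A"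
  shows "trace (D ** W) = trace (G ** X)"
proof -
  have G: "G = D - transpose A ** D ** A" and W: "W = X - A ** X ** transpose A"
    by (rule eq_diff_eq[THEN iffD2, OF assms(1)[symmetric]],
        rule eq_diff_eq[THEN iffD2, OF assms(2)[symmetric]])
  have "trace (D ** (A ** X ** transpose A)) = trace (transpose A ** D ** A ** X)"
    using trace_mul_sym[of "D ** A ** X" "transpose A"] by (simp only: matrix_mul_assoc)
  then show ?thesis
    unfolding G W by (simp add: matrix_linear_simps trace_linear_simps matrix_mul_assoc)
qed

text \<open>For the gain \<open>F\<close> with value matrix \<open>P\<close> this is
  \<open>(R + B^T P B) F - B^T P A\<close>; the gradient of the cost in \<open>F\<close> is twice its product with
  the state covariance. It vanishes at the optimal gain.\<close>

definition half_natural_gradient ::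
    "real^'n^'n \<Rightarrow> real^'m^'n \<Rightarrow> real^'m^'m \<Rightarrow> real^'n^'n \<Rightarrow> real^'n^'m \<Rightarrow> real^'n^'m" where
  "half_natural_gradient A B R P F = R ** F - transpose B ** P ** (A - B ** F)"

text \<open>The advantage of the gain \<open>F + D\<close> over \<open>F\<close>: what one step under \<open>F + D\<close> costs more than
  one under \<open>F\<close>, if the state reached is charged with the value matrix \<open>P\<close> of \<open>F\<close>. Here \<open>E\<close> is
  the half natural gradient at \<open>F\<close>.\<close>

definition gain_change ::
    "real^'m^'n \<Rightarrow> real^'m^'m \<Rightarrow> real^'n^'n \<Rightarrow> real^'n^'m \<Rightarrow> real^'n^'m \<Rightarrow> real^'n^'n" where
  "gain_change B R P E D = transpose D ** E + transpose E ** D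
     + transpose D ** (R + transpose B ** P ** B) ** D"

lemma gain_change_eq:
  fixes F D :: "real^'n^'m"
  assumes "transpose R = R" "transpose P = P"
  shows "gain_change B R P (half_natural_gradient A B R P F) D
    = transpose (F + D) ** R ** (F + D)
      + transpose (A - B ** (F + D)) ** P ** (A - B ** (F + D))
      - (transpose F ** R ** F + transpose (A - B ** F) ** P ** (A - B ** F))"
  unfolding gain_change_def half_natural_gradient_def
  by (simp add: matrix_linear_simps transpose_linear_simps matrix_transpose_mul matrix_mult_assoc
      assms)

text \<open>The advantage of \<open>F'\<close> over \<open>F\<close> is collected along the trajectories of \<open>F'\<close>: the difference
  \<open>P' - P\<close> solves the Stein equation of the closed loop with \<open>F'\<close>, whose right-hand side is the
  advantage, and duality moves the solution operator onto the initial covariance.\<close>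

lemma cost_difference:
  fixes F F' :: "real^'n^'m"
  assumes sym: "transpose R = R" "transpose P = P"
    and P: "P = W + transpose F ** R ** F + transpose (A - B ** F) ** P ** (A - B ** F)"
    and P': "P' = W + transpose F' ** R ** F' + transpose (A - B ** F') ** P' ** (A - B ** F')"
    and X': "X' = \<Sigma>\<^sub>0 + (A - B ** F') ** X' ** transpose (A - B ** F')"
  shows "trace (P' ** \<Sigma>\<^sub>0) - trace (P ** \<Sigma>\<^sub>0)
    = trace (gain_change B R P (half_natural_gradient A B R P F) (F' - F) ** X')"
proof -
  let ?A' = "A - B ** F'"
  let ?G = "gain_change B R P (half_natural_gradient A B R P F) (F' - F)"
  have "?G = transpose F' ** R ** F' + transpose ?A' ** P ** ?A'
      - (transpose F ** R ** F + transpose (A - B ** F) ** P ** (A - B ** F))"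
    using gain_change_eq[OF sym, of B A F "F' - F"] by (simp only: add.commute[of F] diff_add_cancel)
  moreover have "transpose F ** R ** F + transpose (A - B ** F) ** P ** (A - B ** F) = P - W"
    by (subst eq_diff_eq) (use P in \<open>simp only: ac_simps\<close>)
  moreover have "transpose F' ** R ** F' = P' - W - transpose ?A' ** P' ** ?A'"
    by (subst eq_diff_eq, subst eq_diff_eq) (use P' in \<open>simp only: ac_simps\<close>)
  ultimately have "P' - P = ?G + transpose ?A' ** (P' - P) ** ?A'"
    by (simp add: matrix_linear_simps)
  from trace_stein_duality[OF this X'] show ?thesis
    by (simp add: matrix_linear_simps trace_linear_simps)
qed

text \<open>Complete the square: with \<open>d = D x\<close> and \<open>e = E x\<close>, the sum
  \<open>\<sigma> \<bar>d\<bar>\<^sup>2 + 2 d \<bullet> e + \<bar>e\<bar>\<^sup>2 / \<sigma>\<close> equals \<open>\<bar>\<sigma> d + e\<bar>\<^sup>2 / \<sigma>\<close>. The terms with \<open>P\<close> only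
  add to it. So no change of gain improves the one-step cost by more than \<open>\<bar>e\<bar>\<^sup>2 / \<sigma>\<close>.\<close>

lemma gain_change_lower_bound:
  fixes D E :: "real^'n^'m"
  assumes P: "pos_semidef P" and "0 < \<sigma>" and R: "\<And>u. \<sigma> * (u \<bullet> u) \<le> u \<bullet> (R *v u)"
  shows "0 \<le> x \<bullet> ((gain_change B R P E D + (1 / \<sigma>) *\<^sub>R (transpose E ** E)) *v x)"
proof -
  define d e where "d = D *v x" and "e = E *v x"
  have "0 \<le> ((\<sigma> *\<^sub>R d + e) \<bullet> (\<sigma> *\<^sub>R d + e)) / \<sigma>" using \<open>0 < \<sigma>\<close> by simp
  also have "\<dots> = \<sigma> * (d \<bullet> d) + 2 * (d \<bullet> e) + (e \<bullet> e) / \<sigma>"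
    using \<open>0 < \<sigma>\<close> by (simp add: inner_simps inner_commute field_simps)
  also have "\<dots> \<le> d \<bullet> (R *v d) + (B *v d) \<bullet> (P *v (B *v d)) + 2 * (d \<bullet> e) + (e \<bullet> e) / \<sigma>"
    using R[of d] P unfolding pos_semidef_def by (smt (verit))
  also have "\<dots> = x \<bullet> ((gain_change B R P E D + (1 / \<sigma>) *\<^sub>R (transpose E ** E)) *v x)"
    unfolding gain_change_def mult_vec_linear_simps inner_add_right matrix_mult_assoc d_def e_def
      inner_scaleR_right
    by (simp only: matrix_vector_mul_assoc[symmetric] inner_transpose_mult mult_vec_linear_simps
        inner_add_right) (simp add: inner_commute)
  finally show ?thesis .
qed

lemma trace_mult_le_spectral_norm:
  fixes X :: "real^'n^'n" and E :: "real^'n^'m"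
  shows "trace (transpose E ** E ** X) \<le> spectral_norm X * (norm E)\<^sup>2"
proof -
  have "trace (transpose E ** E ** X) = trace (X ** (transpose E ** E))"
    by (rule trace_mul_sym)
  moreover have "0 \<le> trace ((spectral_norm X *\<^sub>R mat 1 - X) ** (transpose E ** E))"
  proof (rule trace_mult_psd_nonneg)
    fix x
    have "x \<bullet> (X *v x) \<le> norm x * norm (X *v x)" by (rule norm_cauchy_schwarz)
    also have "\<dots> \<le> norm x * (spectral_norm X * norm x)"
      by (intro mult_left_mono norm_mult_vec_le_spectral_norm) simp
    finally show "0 \<le> x \<bullet> ((spectral_norm X *\<^sub>R mat 1 - X) *v x)"
      by (simp add: mult_vec_linear_simps inner_simps dot_square_norm power2_eq_square mult_ac)
  next
    have "0 \<le> x \<bullet> ((transpose E ** E) *v x)" for x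
      by (simp only: matrix_vector_mul_assoc[symmetric] inner_transpose_mult) simp
    then show "pos_semidef (transpose E ** E)"
      by (simp add: pos_semidef_def matrix_transpose_mul)
  qed
  ultimately show ?thesis
    by (simp add: matrix_linear_simps trace_linear_simps power2_norm_eq_inner inner_matrix_eq_trace)
qed

lemma trace_gain_change_ge:
  fixes D E :: "real^'n^'m"
  assumes "pos_semidef P" "pos_semidef X" "0 < \<sigma>" "\<And>u. \<sigma> * (u \<bullet> u) \<le> u \<bullet> (R *v u)"
  shows "- (spectral_norm X / \<sigma> * (norm E)\<^sup>2) \<le> trace (gain_change B R P E D ** X)"
proof -
  have "0 \<le> trace ((gain_change B R P E D + (1 / \<sigma>) *\<^sub>R (transpose E ** E)) ** X)"
    using assms by (intro trace_mult_psd_nonneg gain_change_lower_bound)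
  also have "\<dots> = trace (gain_change B R P E D ** X) + trace (transpose E ** E ** X) / \<sigma>"
    by (simp add: matrix_linear_simps trace_linear_simps)
  also have "\<dots> \<le> trace (gain_change B R P E D ** X) + spectral_norm X * (norm E)\<^sup>2 / \<sigma>"
    using assms(3) by (intro add_left_mono divide_right_mono trace_mult_le_spectral_norm) simp
  finally show ?thesis by simp
qed

section \<open>The gradient of the cost\<close>

lemma inner_mult_right_transpose: "(M ** N) \<bullet> Y = M \<bullet> (Y ** transpose N)"
  for M :: "real^'k^'m" and N :: "real^'n^'k"
  unfolding inner_matrix_eq_trace matrix_transpose_mul
  by (metis matrix_mul_assoc trace_mul_sym)

lemma trace_gain_change_eq_inner:
  fixes D E :: "real^'n^'m"
  assumes X: "transpose X = X"
  shows "trace (gain_change B R P E D ** X)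
    = D \<bullet> (2 *\<^sub>R (E ** X) + (R + transpose B ** P ** B) ** D ** X)"
proof -
  have "trace (transpose E ** D ** X) = trace (X ** (transpose D ** E))"
    by (subst trace_transpose[symmetric]) (simp add: matrix_transpose_mul X)
  also have "\<dots> = D \<bullet> (E ** X)"
    unfolding inner_matrix_eq_trace matrix_mul_assoc[symmetric] by (metis matrix_mul_assoc trace_mul_sym)
  finally show ?thesis
    by (simp add: gain_change_def matmul.add_left matmul.add_right trace_linear_simps inner_add_right
        inner_matrix_eq_trace[of D] matrix_mult_assoc)
qed

text \<open>Caratheodory's form of differentiability: an exact linear expression of the increment, with a
  coefficient that is merely continuous at the point, already gives the gradient.\<close>

lemma GDERIV_Caratheodory:
  assumes ev: "eventually (\<lambda>y. f y - f x = (y - x) \<bullet> g y) (nhds x)"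
    and g: "(g \<longlongrightarrow> g x) (nhds x)"
  shows "GDERIV f x :> g x"
  unfolding gderiv_def has_derivative_within
proof (intro conjI)
  show "bounded_linear (\<lambda>h. h \<bullet> g x)" by (rule bounded_linear_inner_left)
  have "eventually (\<lambda>y. norm ((1 / norm (y - x)) *\<^sub>R (f y - (f x + (y - x) \<bullet> g x)))
      \<le> norm (g y - g x)) (at x)"
    unfolding eventually_at_filter using ev
  proof eventually_elim
    case (elim y)
    have "f y - (f x + (y - x) \<bullet> g x) = (y - x) \<bullet> (g y - g x)"
      using elim by (simp add: inner_diff_right)
    moreover have "\<bar>(y - x) \<bullet> (g y - g x)\<bar> \<le> norm (y - x) * norm (g y - g x)"
      by (rule Cauchy_Schwarz_ineq2)
    ultimately show ?case by (cases "y = x") (simp_all add: divide_le_eq mult.commute)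
  qed
  moreover have "((\<lambda>y. norm (g y - g x)) \<longlongrightarrow> 0) (at x)"
    using g unfolding tendsto_at_iff_tendsto_nhds[symmetric]
    by (simp add: tendsto_norm_zero_iff LIM_zero_iff)
  ultimately show "((\<lambda>y. (1 / norm (y - x)) *\<^sub>R (f y - (f x + (y - x) \<bullet> g x))) \<longlongrightarrow> 0) (at x)"
    by (rule Lim_null_comparison)
qed

lemma gradient_eqI:
  assumes "GDERIV f x :> D"
  shows "gradient f x = D"
  unfolding gradient_def
proof (rule the_equality[where P = "\<lambda>D. GDERIV f x :> D", OF assms])
  fix D' assume "GDERIV f x :> D'"
  with assms have "(\<lambda>h. h \<bullet> D') = (\<lambda>h. h \<bullet> D)"
    unfolding gderiv_def using has_derivative_unique by blast
  then have "(D' - D) \<bullet> D' = (D' - D) \<bullet> D" by metis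
  then have "(D' - D) \<bullet> (D' - D) = 0" by (simp add: inner_diff_right)
  then show "D' = D" by simp
qed

lemma closed_loop_eq: "closed_loop A B S K = A - B ** (K ** right_pinv S)"
  by (simp add: closed_loop_def matrix_mul_assoc)

text \<open>The value matrix is a Stein solution for the transposed closed loop, so the defining
  description picks out exactly one matrix.\<close>

lemma cost_matrix:
  fixes C :: "real^'n^'d"
  assumes stable: "schur_stable (closed_loop A B S K)" and "pos_semidef Q" "pos_semidef R"
  defines "P \<equiv> cost_matrix A B C Q R S K" and "F \<equiv> K ** right_pinv S"
  shows "pos_semidef P"
    and "P = transpose C ** Q ** C + transpose F ** R ** F + transpose (A - B ** F) ** P ** (A - B ** F)"
proof -
  define W where "W = transpose C ** Q ** C + transpose F ** R ** F"
  define eq where "eq P \<longleftrightarrow>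
    P = W + transpose (closed_loop A B S K) ** P ** transpose (transpose (closed_loop A B S K))" for P
  have "pos_semidef W"
    unfolding W_def using assms by (intro psd_add psd_congruence)
  have ex1: "\<exists>!P. eq P"
    unfolding eq_def by (rule stein_ex1[OF schur_stable_transpose[OF stable]])
  have "\<exists>!P. pos_semidef P \<and> eq P"
    using ex1 stein_psd[OF schur_stable_transpose[OF stable] _ \<open>pos_semidef W\<close>]
    unfolding eq_def by metis
  from theI'[OF this] have "pos_semidef P \<and> eq P"
    unfolding P_def cost_matrix_def eq_def W_def F_def
    by (simp only: matrix_transpose_mul matrix_mul_assoc transpose_transpose)
  then show "pos_semidef P"
    and "P = transpose C ** Q ** C + transpose F ** R ** F + transpose (A - B ** F) ** P ** (A - B ** F)"
    unfolding eq_def W_def closed_loop_eq F_def transpose_transpose by blast+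
qed

lemma state_covariance:
  assumes stable: "schur_stable (closed_loop A B S K)" and "pos_semidef \<Sigma>\<^sub>0"
  defines "X \<equiv> state_covariance A B \<Sigma>\<^sub>0 S K"
  shows "X = \<Sigma>\<^sub>0 + closed_loop A B S K ** X ** transpose (closed_loop A B S K)"
    and "pos_semidef X"
proof -
  show X: "X = \<Sigma>\<^sub>0 + closed_loop A B S K ** X ** transpose (closed_loop A B S K)"
    unfolding X_def state_covariance_def by (rule theI'[OF stein_ex1[OF stable]])
  show "pos_semidef X" by (rule stein_psd[OF stable X assms(2)])
qed

lemma pos_def_state_covariance:
  assumes stable: "schur_stable (closed_loop A B S K)" and "pos_def \<Sigma>\<^sub>0"
  shows "pos_def (state_covariance A B \<Sigma>\<^sub>0 S K)"
proof -
  let ?X = "state_covariance A B \<Sigma>\<^sub>0 S K" and ?A = "closed_loop A B S K"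
  note X = state_covariance[OF stable pos_def_imp_psd[OF assms(2)]]
  have "0 < x \<bullet> (?X *v x)" if "x \<noteq> 0" for x
  proof -
    have "0 < x \<bullet> (\<Sigma>\<^sub>0 *v x)" using assms(2) that by (simp add: pos_def_def)
    moreover have "0 \<le> x \<bullet> ((transpose (transpose ?A) ** ?X ** transpose ?A) *v x)"
      using psd_congruence[OF X(2)] unfolding pos_semidef_def by blast
    moreover have "x \<bullet> (?X *v x) = x \<bullet> (\<Sigma>\<^sub>0 *v x) + x \<bullet> ((?A ** ?X ** transpose ?A) *v x)"
      by (subst X(1)) (simp only: mult_vec_linear_simps inner_add_right)
    ultimately show ?thesis by simp
  qed
  then show ?thesis using X(2) by (simp add: pos_def_def pos_semidef_def)
qed

lemma lqr_cost_difference: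
  fixes C :: "real^'n^'d"
  assumes "pos_semidef Q" "pos_semidef R" "pos_semidef \<Sigma>\<^sub>0"
    and stable: "schur_stable (closed_loop A B S K)" and stable': "schur_stable (closed_loop A B S K')"
  defines "P \<equiv> cost_matrix A B C Q R S K"
  shows "lqr_cost A B C Q R \<Sigma>\<^sub>0 S K' - lqr_cost A B C Q R \<Sigma>\<^sub>0 S K
    = trace (gain_change B R P (half_natural_gradient A B R P (K ** right_pinv S))
        ((K' - K) ** right_pinv S) ** state_covariance A B \<Sigma>\<^sub>0 S K')"
proof -
  have sym: "transpose R = R" "transpose P = P"
    using assms(2) cost_matrix(1)[OF stable assms(1,2)] by (simp_all add: P_def pos_semidef_def)
  show ?thesis
    unfolding lqr_cost_def P_def[symmetric] matmul.diff_left
    by (rule cost_difference[OF sym cost_matrix(2)[OF stable assms(1,2), of C, folded P_def]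
          cost_matrix(2)[OF stable' assms(1,2), of C]
          state_covariance(1)[OF stable' assms(3), unfolded closed_loop_eq]])
qed

text \<open>The cost difference formula expresses the increment of the cost exactly as an inner product
  of \<open>K' - K\<close> with a matrix \<open>g K'\<close> that contains the covariance of \<open>K'\<close>, not of \<open>K\<close>. Continuity of
  the covariance is therefore all that differentiability needs, and no derivative of the value
  matrix is computed.\<close>

lemma gradient_lqr_cost:
  fixes C :: "real^'n^'d"
  assumes "pos_semidef Q" "pos_semidef R" "pos_semidef \<Sigma>\<^sub>0"
    and stable: "schur_stable (closed_loop A B S K)"
  defines "E \<equiv> half_natural_gradient A B R (cost_matrix A B C Q R S K) (K ** right_pinv S)"
  shows "gradient (lqr_cost A B C Q R \<Sigma>\<^sub>0 S) K
    = 2 *\<^sub>R (E ** state_covariance A B \<Sigma>\<^sub>0 S K ** transpose (right_pinv S))"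
proof -
  define H where "H = R + transpose B ** cost_matrix A B C Q R S K ** B"
  define X where "X = state_covariance A B \<Sigma>\<^sub>0 S"
  define g where "g K' = (2 *\<^sub>R (E ** X K') + H ** ((K' - K) ** right_pinv S) ** X K')
    ** transpose (right_pinv S)" for K'
  have cl: "filterlim (closed_loop A B S) (nhds (closed_loop A B S K)) (nhds K)"
    unfolding closed_loop_def
    by (intro tendsto_intros matmul.tendsto filterlim_ident)
  have "eventually (\<lambda>K'. schur_stable (closed_loop A B S K')) (nhds K)"
    using eventually_compose_filterlim[OF eventually_schur_stable[OF stable] cl] .
  then have diff: "eventually (\<lambda>K'. lqr_cost A B C Q R \<Sigma>\<^sub>0 S K' - lqr_cost A B C Q R \<Sigma>\<^sub>0 S K
      = (K' - K) \<bullet> g K') (nhds K)"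
  proof eventually_elim
    case (elim K')
    have "transpose (X K') = X K'"
      using state_covariance(2)[OF elim assms(3)] by (simp add: X_def pos_semidef_def)
    then show ?case
      unfolding lqr_cost_difference[OF assms(1-3) stable elim] E_def[symmetric] X_def[symmetric]
      by (simp only: trace_gain_change_eq_inner inner_mult_right_transpose g_def H_def)
  qed
  have "((\<lambda>A'. THE X. X = \<Sigma>\<^sub>0 + A' ** X ** transpose A')
      \<longlongrightarrow> (THE X. X = \<Sigma>\<^sub>0 + closed_loop A B S K ** X ** transpose (closed_loop A B S K)))
    (nhds (closed_loop A B S K))"
    by (rule stein_solution_tendsto[OF stable]) (rule theI'[OF stein_ex1])
  from filterlim_compose[OF this cl] have "(X \<longlongrightarrow> X K) (nhds K)"
    unfolding X_def state_covariance_def .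
  then have "(g \<longlongrightarrow> g K) (nhds K)"
    unfolding g_def by (intro tendsto_intros matmul.tendsto filterlim_ident)
  from gradient_eqI[OF GDERIV_Caratheodory[OF diff this]] show ?thesis
    by (simp add: g_def X_def matmul.zero_left matmul.zero_right matmul.scaleR_left)
qed

section \<open>Gradient dominance\<close>

text \<open>With \<open>E\<close> the half natural gradient at \<open>K\<close>, the cost difference formula and the lower bound
  on the advantage give \<open>J K - J K' \<le> spectral_norm (\<Sigma> K') / sigma_min R * (norm E)\<^sup>2\<close>. Conversely \<open>E\<close> is recovered
  from the gradient \<open>2 E (\<Sigma> K) (S^\<dagger>)^T\<close>: multiplication by \<open>S^T\<close> cancels the
  pseudoinverse, at the price of a factor \<open>spectral_norm S\<close>, and cancelling \<open>\<Sigma> K\<close> costs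
  \<open>1 / sigma_min (\<Sigma> K)\<close>. The factor \<open>4\<close> is the square of the \<open>2\<close> in the gradient.\<close>

lemma gradient_dominance:
  fixes C :: "real^'n^'d"
  assumes Q: "pos_semidef Q" and R: "pos_def R" and \<Sigma>\<^sub>0: "pos_def \<Sigma>\<^sub>0"
    and S: "S ** right_pinv S = mat 1"
    and stable: "schur_stable (closed_loop A B S K)" and stable': "schur_stable (closed_loop A B S K')"
  defines "J \<equiv> lqr_cost A B C Q R \<Sigma>\<^sub>0 S" and "\<Sigma> \<equiv> state_covariance A B \<Sigma>\<^sub>0 S"
  shows "J K - J K' \<le> spectral_norm (\<Sigma> K') * (spectral_norm S)\<^sup>2
      / (4 * sigma_min R * (sigma_min (\<Sigma> K))\<^sup>2)
    * trace (transpose (gradient J K) ** gradient J K)"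
proof -
  note psd = pos_def_imp_psd
  define P where "P = cost_matrix A B C Q R S K"
  define E where "E = half_natural_gradient A B R P (K ** right_pinv S)"
  define G where "G = gradient J K"
  define s where "s = sigma_min (\<Sigma> K)"
  have pdX: "pos_def (\<Sigma> K)" unfolding \<Sigma>_def by (rule pos_def_state_covariance[OF stable \<Sigma>\<^sub>0])
  then have s: "0 < s" unfolding s_def by (rule sigma_min_pos)
  have r: "0 < sigma_min R" by (rule sigma_min_pos[OF R])
  have "J K' - J K = trace (gain_change B R P E ((K' - K) ** right_pinv S) ** \<Sigma> K')"
    unfolding J_def \<Sigma>_def P_def E_def by (rule lqr_cost_difference[OF Q psd[OF R] psd[OF \<Sigma>\<^sub>0] stable stable'])
  also have "- (spectral_norm (\<Sigma> K') / sigma_min R * (norm E)\<^sup>2) \<le> \<dots>"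
    using cost_matrix(1)[OF stable Q psd[OF R]] state_covariance(2)[OF stable' psd[OF \<Sigma>\<^sub>0]] r
      sigma_min_le_quadratic_form[of R] R
    unfolding P_def \<Sigma>_def by (intro trace_gain_change_ge) (simp_all add: pos_def_def)
  finally have J: "J K - J K' \<le> spectral_norm (\<Sigma> K') / sigma_min R * (norm E)\<^sup>2" by simp
  have "transpose (right_pinv S) ** transpose S = mat 1"
    using S by (metis matrix_transpose_mul transpose_mat)
  then have "G ** transpose S = 2 *\<^sub>R (E ** \<Sigma> K)"
    using gradient_lqr_cost[OF Q psd[OF R] psd[OF \<Sigma>\<^sub>0] stable]
    unfolding G_def J_def \<Sigma>_def E_def P_def
    by (simp add: matmul.scaleR_left matrix_mult_assoc)
  then have "2 * norm (E ** \<Sigma> K) \<le> spectral_norm S * norm G"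
    using norm_mult_transpose_le[of G S] by simp
  moreover have "s * norm E \<le> norm (E ** \<Sigma> K)"
    using sigma_min_norm_mult_le[of "\<Sigma> K" E] pdX s unfolding s_def by (simp add: pos_def_def)
  ultimately have "2 * s * norm E \<le> spectral_norm S * norm G" by simp
  then have "(2 * s * norm E)\<^sup>2 \<le> (spectral_norm S * norm G)\<^sup>2"
    using s by (intro power_mono) auto
  then have "(norm E)\<^sup>2 \<le> (spectral_norm S)\<^sup>2 * (norm G)\<^sup>2 / (4 * s\<^sup>2)"
    using s by (simp add: power_mult_distrib field_simps)
  then have "spectral_norm (\<Sigma> K') / sigma_min R * (norm E)\<^sup>2
    \<le> spectral_norm (\<Sigma> K') / sigma_min R * ((spectral_norm S)\<^sup>2 * (norm G)\<^sup>2 / (4 * s\<^sup>2))"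
    using r spectral_norm_nonneg[of "\<Sigma> K'"] by (intro mult_left_mono) auto
  with J have "J K - J K'
    \<le> spectral_norm (\<Sigma> K') * (spectral_norm S)\<^sup>2 / (4 * sigma_min R * s\<^sup>2) * (norm G)\<^sup>2"
    by (simp add: field_simps)
  then show ?thesis
    by (simp add: G_def s_def power2_norm_eq_inner inner_matrix_eq_trace)
qed

section \<open>Full row rank of the state matrix\<close>

lemma range_pos: "range (pos :: 'p::{finite,linorder} \<Rightarrow> nat) = {..<CARD('p)}"
proof (rule card_subset_eq)
  have less: "pos i < pos j" if "i < j" for i j :: 'p
    unfolding pos_def using that by (intro psubset_card_mono) auto
  have "inj (pos :: 'p \<Rightarrow> nat)"
    by (intro injI) (metis less less_irrefl linorder_less_linear)
  then show "card (range (pos :: 'p \<Rightarrow> nat)) = card {..<CARD('p)}" by (simp add: card_image)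
  show "range (pos :: 'p \<Rightarrow> nat) \<subseteq> {..<CARD('p)}"
    unfolding pos_def by (auto intro!: psubset_card_mono)
qed simp

text \<open>The rank of the columns of \<open>A^i B\<close>, \<open>i < k\<close>, is full at the controllability index and grows
  with \<open>k\<close>. So these columns span the space, and a vector orthogonal to them is orthogonal to
  itself.\<close>

lemma ctrb_matrix_left_kernel:
  fixes A :: "real^'n^'n" and B :: "real^'m^'n" and v :: "real^'n"
  assumes contr: "controllable A B" and index: "controllability_index A B \<le> CARD('p)"
    and v: "v v* (ctrb_matrix A B :: real^('p::{finite,linorder} \<times> 'm)^'n) = 0"
  shows "v = 0"
proof -
  let ?T = "\<lambda>k. \<Union>i<k. columns (matpow A i ** B)"
  have "controllability_rank A B (controllability_index A B) = CARD('n)"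
    using contr unfolding controllability_index_def controllable_def by (rule LeastI)
  then have "CARD('n) \<le> dim (?T CARD('p))"
    using index dim_subset[of "?T (controllability_index A B)" "?T CARD('p)"]
    unfolding controllability_rank_def by fastforce
  then have full: "span (?T CARD('p)) = UNIV"
    using dim_subset_UNIV[of "?T CARD('p)"] by (simp add: dim_eq_full[symmetric])
  have "orthogonal v w" if member: "w \<in> ?T CARD('p)" for w
  proof -
    obtain i where "i < CARD('p)" "w \<in> columns (matpow A i ** B)" using member by blast
    then obtain r where w: "w = column r (matpow A i ** B)" by (auto simp: columns_def)
    obtain j :: 'p where "pos j = i"
      using \<open>i < CARD('p)\<close> range_pos[where 'p = 'p] by (metis imageE lessThan_iff)
    with v w show ?thesis
      by (auto simp: vec_eq_iff orthogonal_def inner_vec_def vector_matrix_mult_def ctrb_matrix_def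
          column_def mult.commute dest: spec[of _ "(j, r)"])
  qed
  then have "orthogonal v v"
    using orthogonal_to_span[of v "?T CARD('p)" v] full by (simp add: orthogonal_commute)
  then show ?thesis by (simp add: orthogonal_def)
qed

text \<open>The input block of the matrix is the controllability matrix minus \<open>Y T\<close>, with \<open>Y\<close> the output
  block and \<open>T\<close> the Toeplitz matrix. A row vector that annihilates \<open>Y\<close> and the input block
  thus annihilates the controllability matrix.\<close>

lemma io_state_matrix_left_kernel:
  fixes A :: "real^'n^'n" and B :: "real^'m^'n" and C :: "real^'n^'d"
  assumes "controllable A B" "controllability_index A B \<le> CARD('p)"
    and v: "v v* (io_state_matrix A B C :: real^(('p::{finite,linorder} \<times> 'm) + ('p \<times> 'd))^'n) = 0"
  shows "v = 0"
proof -
  define Y where "Y = matpow A CARD('p) ** left_pinv (obsv_matrix C A :: real^'n^('p \<times> 'd))"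
  define T where "T = (toeplitz_matrix A B C :: real^('p \<times> 'm)^('p \<times> 'd))"
  define U where "U = ctrb_matrix A B - Y ** T"
  have S: "io_state_matrix A B C = (\<chi> s k. case k of Inl a \<Rightarrow> U $ s $ a | Inr b \<Rightarrow> Y $ s $ b)"
    unfolding io_state_matrix_def Let_def Y_def T_def U_def ..
  have "(v v* U) $ a = 0" for a
    using v unfolding S by (auto simp: vector_matrix_mult_def vec_eq_iff dest: spec[of _ "Inl a"])
  then have U: "v v* U = 0" by (simp add: vec_eq_iff)
  have "(v v* Y) $ b = 0" for b
    using v unfolding S by (auto simp: vector_matrix_mult_def vec_eq_iff dest: spec[of _ "Inr b"])
  then have Y: "v v* Y = 0" by (simp add: vec_eq_iff)
  have "v v* (ctrb_matrix A B :: real^('p \<times> 'm)^'n) = v v* (U + Y ** T)"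
    by (simp add: U_def)
  also have "\<dots> = 0"
    using U Y by (simp add: vector_matrix_mult_add_rdistrib vector_matrix_mul_assoc[symmetric])
  finally show ?thesis by (rule ctrb_matrix_left_kernel[OF assms(1,2)])
qed

text \<open>Full row rank makes the Gram matrix \<open>S S^T\<close> invertible, because its quadratic form at \<open>v\<close> is
  \<open>\<bar>S^T v\<bar>\<^sup>2\<close>.\<close>

lemma right_pinv_inverse:
  fixes S :: "real^'q^'n"
  assumes "\<And>v. v v* S = 0 \<Longrightarrow> v = 0"
  shows "S ** right_pinv S = mat 1"
proof -
  have "v = 0" if "(S ** transpose S) *v v = 0" for v
  proof -
    have "(transpose S *v v) \<bullet> (transpose S *v v) = v \<bullet> ((S ** transpose S) *v v)"
      by (simp only: matrix_vector_mul_assoc[symmetric] inner_transpose_mult inner_commute)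
    then have "transpose S *v v = 0" unfolding that by simp
    then show ?thesis using assms by simp
  qed
  then have "invertible (S ** transpose S)"
    unfolding invertible_left_inverse matrix_left_invertible_ker by blast
  then have "(S ** transpose S) ** matrix_inv (S ** transpose S) = mat 1"
    unfolding matrix_inv_def invertible_def by (rule someI2_ex) simp
  then show ?thesis by (simp add: right_pinv_def matrix_mul_assoc)
qed

theorem lemma7:
  fixes A :: "real^'n^'n" and B :: "real^'m^'n" and C :: "real^'n^'d"
    and Q :: "real^'d^'d" and R :: "real^'m^'m"
    and M :: "'w measure" and x\<^sub>0 :: "'w \<Rightarrow> real^'n"
    and \<Sigma>\<^sub>0 Pstar :: "real^'n^'n"
    and S :: "real^(('p::{finite,linorder} \<times> 'm) + ('p \<times> 'd))^'n"
    and J :: "real^(('p \<times> 'm) + ('p \<times> 'd))^'m \<Rightarrow> real"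
    and \<Sigma> :: "real^(('p \<times> 'm) + ('p \<times> 'd))^'m \<Rightarrow> real^'n^'n"
    and K Kstar :: "real^(('p \<times> 'm) + ('p \<times> 'd))^'m"
  assumes "controllable A B" and "observable C A"
    and "pos_semidef Q" and "pos_def R"
    and "prob_space M" and "x\<^sub>0 \<in> borel_measurable M"
    and "integrable M (\<lambda>\<omega>. outer_product (x\<^sub>0 \<omega>) (x\<^sub>0 \<omega>))"
    and "(\<integral>\<omega>. x\<^sub>0 \<omega> \<partial>M) = 0"
    and "\<Sigma>\<^sub>0 = (\<integral>\<omega>. outer_product (x\<^sub>0 \<omega>) (x\<^sub>0 \<omega>) \<partial>M)"
    and "pos_def \<Sigma>\<^sub>0"
    and "CARD('p) = max (observability_index C A) (controllability_index A B)"
    and "S = io_state_matrix A B C"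
    and "J = lqr_cost A B C Q R \<Sigma>\<^sub>0 S"
    and "\<Sigma> = state_covariance A B \<Sigma>\<^sub>0 S"
    and "pos_semidef Pstar" and "riccati A B C Q R Pstar"
    and "\<And>P. pos_semidef P \<Longrightarrow> riccati A B C Q R P \<Longrightarrow> P = Pstar"
    and "Kstar = riccati_policy A B R S Pstar"
    and "is_arg_min J (\<lambda>K'. K' \<in> feasible_policies A B S) Kstar"
    and "K \<in> feasible_policies A B S"
  shows "J K - J Kstar \<le>
    spectral_norm (\<Sigma> Kstar) * (spectral_norm S)\<^sup>2
      / (4 * sigma_min R * (sigma_min (\<Sigma> K))\<^sup>2)
    * trace (transpose (gradient J K) ** gradient J K)"
proof -
  have "S ** right_pinv S = mat 1"
  proof (rule right_pinv_inverse)
    fix v assume "v v* S = 0"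
    then show "v = 0"
      unfolding \<open>S = io_state_matrix A B C\<close>
      using \<open>CARD('p) = _\<close> by (intro io_state_matrix_left_kernel[OF \<open>controllable A B\<close>]) simp_all
  qed
  moreover have "schur_stable (closed_loop A B S K')" if "K' \<in> feasible_policies A B S" for K'
    using that unfolding feasible_policies_def by (auto intro: spectral_radius_less_1_imp_schur_stable)
  moreover have "Kstar \<in> feasible_policies A B S"
    using \<open>is_arg_min J _ Kstar\<close> by (simp add: is_arg_min_def)
  ultimately show ?thesis
    unfolding \<open>J = _\<close> \<open>\<Sigma> = _\<close>
    using \<open>K \<in> _\<close> by (intro gradient_dominance \<open>pos_semidef Q\<close> \<open>pos_def R\<close> \<open>pos_def \<Sigma>\<^sub>0\<close>)
qed

end
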